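(* Let $R$ be a unital associative (not necessarily commutative) superalgebra, and let $p,q\ge 0$ be integers with $p+q\ge 1$. The family of Dennis supertrace maps $\left\{\mathrm{Str}^m:M_{p,q}(R)^{\otimes (m+1)}\to R^{\otimes (m+1)}\right\}_{m\ge 0}$ is a chain morphism from the Hochschild complex of the superalgebra $M_{p,q}(R)$ to the Hochschild complex of $R$; that is, each $\mathrm{Str}^m$ is linear and $d^m\circ\mathrm{Str}^m=\mathrm{Str}^{m-1}\circ d^m$ for all $m\ge 1$, where $d^m$ denotes the Hochschild differential of $R$ on the left and of $M_{p,q}(R)$ on the right.
   Context: A superalgebra $R=R_0\oplus R_1$ is a $\mathbb{Z}_2$-graded associative unital algebra over a commutative unital ground ring $k$ (in even degree); $|a|\in\mathbb{Z}_2$ denotes the parity of a homogeneous element $a$. All tensor products are over $k$. $M_{p,q}(R)$ is the algebra of $(p+q)\times(p+q)$ matrices over $R$ with ordinary matrix multiplication, graded as follows. Write $A=\begin{pmatrix}A_{11}&A_{12}\\ A_{21}&A_{22}\end{pmatrix}$ with blocks of sizes $p\times p$, $p\times q$, $q\times p$, $q\times q$. $A$ is even if the entries of $A_{11},A_{22}$ are even and those of $A_{12},A_{21}$ are odd; $A$ is odd if the entries of $A_{11},A_{22}$ are odd and those of $A_{12},A_{21}$ are even. The parity of a homogeneous matrix is denoted $|A|$. With this grading $M_{p,q}(R)$ is a unital superalgebra. Hochschild complex of a superalgebra $S$: $C_m(S)=S^{\otimes (m+1)}$ for $m\ge 0$; for $m\ge1$ the face maps $\delta^m_i:C_m(S)\to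 C_{m-1}(S)$ are the linear maps given on homogeneous elements by $$\delta^m_i(a_0\otimes\dots\otimes a_m)=a_0\otimes\dots\otimes a_ia_{i+1}\otimes\dots\otimes a_m\quad(0\le i<m),$$ $$\delta^m_m(a_0\otimes\dots\otimes a_m)=(-1)^{|a_m|(|a_0|+\dots+|a_{m-1}|)}a_ma_0\otimes a_1\otimes\dots\otimes a_{m-1},$$ and the differential is $d^m=\sum_{i=0}^m(-1)^i\delta^m_i$ (with $d^0=0$). The Dennis supertrace $\mathrm{Str}^m:M_{p,q}(R)^{\otimes (m+1)}\to R^{\otimes (m+1)}$ is the $k$-linear map defined on homogeneous supermatrices $A^0,\dots,A^m$ by $$\mathrm{Str}^m(A^0\otimes\dots\otimes A^m)=\sum_{i_0=1}^{p}\ \sum_{i_1,\dots,i_m=1}^{p+q} A^0_{i_0i_1}\otimes A^1_{i_1i_2}\otimes\dots\otimes A^{m-1}_{i_{m-1}i_m}\otimes A^m_{i_mi_0}+(-1)^{1+|A^0|+\dots+|A^m|}\sum_{i_0=p+1}^{p+q}\ \sum_{i_1,\dots,i_m=1}^{p+q} A^0_{i_0i_1}\otimes A^1_{i_1i_2}\otimes\dots\otimes A^{m-1}_{i_{m-1}i_m}\otimes A^m_{i_mi_0}.$$ For $m=0$ this is the supertrace: $\mathrm{Str}^0(A)=\mathrm{tr}A_{11}+(-1)^{1+|A|}\mathrm{tr}A_{22}$. *)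

theory Defs
  imports "HOL-Library.Z2" "HOL-Library.FuncSet" "HOL-Algebra.Module" "HOL-Algebra.AbelCoset"
    "Jordan_Normal_Form.Matrix"
begin

section \<open>Superalgebras\<close>

text \<open>Parities live in the two-element field \<^typ>\<open>bit\<close>, read as the integers modulo 2.\<close>

record ('k, 'a) superalgebra = "('k, 'a) module" +
  grade :: "bit \<Rightarrow> 'a set"

locale superalgebra = module K S + ring S
  for K :: "('k, 'z) ring_scheme" (structure)
    and S :: "('k, 'a, 'y) superalgebra_scheme" (structure) +
  assumes smult_mult_left:
      "\<lbrakk>c \<in> carrier K; x \<in> carrier S; y \<in> carrier S\<rbrakk> \<Longrightarrow>
        (c \<odot>\<^bsub>S\<^esub> x) \<otimes>\<^bsub>S\<^esub> y = c \<odot>\<^bsub>S\<^esub> (x \<otimes>\<^bsub>S\<^esub> y)"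
    and smult_mult_right:
      "\<lbrakk>c \<in> carrier K; x \<in> carrier S; y \<in> carrier S\<rbrakk> \<Longrightarrow>
        x \<otimes>\<^bsub>S\<^esub> (c \<odot>\<^bsub>S\<^esub> y) = c \<odot>\<^bsub>S\<^esub> (x \<otimes>\<^bsub>S\<^esub> y)"
    and grade_submodule: "submodule (grade S e) K S"
    and grade_sum: "x \<in> carrier S \<Longrightarrow> \<exists>a\<in>grade S 0. \<exists>b\<in>grade S 1. x = a \<oplus>\<^bsub>S\<^esub> b"
    and grade_inter: "grade S 0 \<inter> grade S 1 = {\<zero>\<^bsub>S\<^esub>}"
    and grade_mult: "\<lbrakk>x \<in> grade S e; y \<in> grade S e'\<rbrakk> \<Longrightarrow> x \<otimes>\<^bsub>S\<^esub> y \<in> grade S (e + e')"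
    and grade_one: "\<one>\<^bsub>S\<^esub> \<in> grade S 0"

text \<open>The sign of a parity exponent, as an element of the ground ring.\<close>

definition parity_sign :: "('k, 'z) ring_scheme \<Rightarrow> bit \<Rightarrow> 'k" where
  "parity_sign K e = (if e = 0 then \<one>\<^bsub>K\<^esub> else \<ominus>\<^bsub>K\<^esub> \<one>\<^bsub>K\<^esub>)"

text \<open>Supermatrices. Row and column indices start at 0, so an index is in the first
  (even) block iff it is smaller than \<open>p\<close>.\<close>

definition supermatrices ::
    "('k, 'a, 'y) superalgebra_scheme \<Rightarrow> nat \<Rightarrow> nat \<Rightarrow> ('k, 'a mat) superalgebra" where
  "supermatrices R p q =
    (let n = p + q;
         C = {A \<in> carrier_mat n n. \<forall>i<n. \<forall>j<n. A $$ (i, j) \<in> carrier R}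
     in \<lparr>carrier = C,
         monoid.mult = (\<lambda>A B. mat n n (\<lambda>(i, j). \<Oplus>\<^bsub>R\<^esub>l\<in>{..<n}. A $$ (i, l) \<otimes>\<^bsub>R\<^esub> B $$ (l, j))),
         one = mat n n (\<lambda>(i, j). if i = j then \<one>\<^bsub>R\<^esub> else \<zero>\<^bsub>R\<^esub>),
         zero = mat n n (\<lambda>_. \<zero>\<^bsub>R\<^esub>),
         add = (\<lambda>A B. mat n n (\<lambda>ij. A $$ ij \<oplus>\<^bsub>R\<^esub> B $$ ij)),
         smult = (\<lambda>c A. mat n n (\<lambda>ij. c \<odot>\<^bsub>R\<^esub> A $$ ij)),
         grade = (\<lambda>e. {A \<in> C. \<forall>i<n. \<forall>j<n.
            A $$ (i, j) \<in> grade R (if (i < p) = (j < p) then e else e + 1)})\<rparr>)"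


section \<open>Tensor powers of a module\<close>

text \<open>The record type of modules extends that of rings; for the modules built here the ring
  fields \<open>mult\<close> and \<open>one\<close> carry no meaning and are left undefined.\<close>

definition free_module :: "('k, 'z) ring_scheme \<Rightarrow> 'b set \<Rightarrow> ('k, 'b \<Rightarrow> 'k) module" where
  "free_module K X =
    \<lparr>carrier = {f. (\<forall>x. f x \<in> carrier K) \<and> finite {x. f x \<noteq> \<zero>\<^bsub>K\<^esub>} \<and> {x. f x \<noteq> \<zero>\<^bsub>K\<^esub>} \<subseteq> X},
     monoid.mult = undefined, one = undefined,
     zero = (\<lambda>_. \<zero>\<^bsub>K\<^esub>),
     add = (\<lambda>f g x. f x \<oplus>\<^bsub>K\<^esub> g x),
     smult = (\<lambda>c f x. c \<otimes>\<^bsub>K\<^esub> f x)\<rparr>"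

definition free_gen :: "('k, 'z) ring_scheme \<Rightarrow> 'b \<Rightarrow> 'b \<Rightarrow> 'k" where
  "free_gen K x = (\<lambda>y. if y = x then \<one>\<^bsub>K\<^esub> else \<zero>\<^bsub>K\<^esub>)"

definition generated_submodule ::
    "('k, 'z) ring_scheme \<Rightarrow> ('k, 'b, 'y) module_scheme \<Rightarrow> 'b set \<Rightarrow> 'b set" where
  "generated_submodule K M G = \<Inter>{H. submodule H K M \<and> G \<subseteq> H}"

definition quotient_module ::
    "('k, 'b, 'y) module_scheme \<Rightarrow> 'b set \<Rightarrow> ('k, 'b set) module" where
  "quotient_module M H =
    \<lparr>carrier = a_rcosets\<^bsub>M\<^esub> H,
     monoid.mult = undefined, one = undefined,
     zero = H,
     add = set_add M,
     smult = (\<lambda>c X. \<Union>x\<in>X. H +>\<^bsub>M\<^esub> (c \<odot>\<^bsub>M\<^esub> x))\<rparr>"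

text \<open>The \<open>n\<close>-th tensor power of \<open>S\<close> over \<open>K\<close> is the free \<open>K\<close>-module on the lists of
  length \<open>n\<close> modulo the relations expressing additivity and homogeneity in each entry.\<close>

definition tensor_words :: "('k, 'a, 'y) module_scheme \<Rightarrow> nat \<Rightarrow> 'a list set" where
  "tensor_words S n = {as. length as = n \<and> set as \<subseteq> carrier S}"

definition tensor_free ::
    "('k, 'z) ring_scheme \<Rightarrow> ('k, 'a, 'y) module_scheme \<Rightarrow> nat \<Rightarrow> ('k, 'a list \<Rightarrow> 'k) module" where
  "tensor_free K S n = free_module K (tensor_words S n)"

definition tensor_relations ::
    "('k, 'z) ring_scheme \<Rightarrow> ('k, 'a, 'y) module_scheme \<Rightarrow> nat \<Rightarrow> ('a list \<Rightarrow> 'k) set" where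
  "tensor_relations K S n =
    {free_gen K (as[i := x \<oplus>\<^bsub>S\<^esub> y]) \<ominus>\<^bsub>tensor_free K S n\<^esub>
        (free_gen K (as[i := x]) \<oplus>\<^bsub>tensor_free K S n\<^esub> free_gen K (as[i := y])) | as i x y.
      as \<in> tensor_words S n \<and> i < n \<and> x \<in> carrier S \<and> y \<in> carrier S} \<union>
    {free_gen K (as[i := c \<odot>\<^bsub>S\<^esub> x]) \<ominus>\<^bsub>tensor_free K S n\<^esub>
        (c \<odot>\<^bsub>tensor_free K S n\<^esub> free_gen K (as[i := x])) | as i c x.
      as \<in> tensor_words S n \<and> i < n \<and> c \<in> carrier K \<and> x \<in> carrier S}"

definition tensor_kernel ::
    "('k, 'z) ring_scheme \<Rightarrow> ('k, 'a, 'y) module_scheme \<Rightarrow> nat \<Rightarrow> ('a list \<Rightarrow> 'k) set" where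
  "tensor_kernel K S n = generated_submodule K (tensor_free K S n) (tensor_relations K S n)"

definition tensor_power ::
    "('k, 'z) ring_scheme \<Rightarrow> ('k, 'a, 'y) module_scheme \<Rightarrow> nat \<Rightarrow> ('k, ('a list \<Rightarrow> 'k) set) module" where
  "tensor_power K S n = quotient_module (tensor_free K S n) (tensor_kernel K S n)"

text \<open>\<open>pure_tensor K S [a\<^sub>1, \<dots>, a\<^sub>n]\<close> is \<open>a\<^sub>1 \<otimes> \<dots> \<otimes> a\<^sub>n\<close>.\<close>

definition pure_tensor ::
    "('k, 'z) ring_scheme \<Rightarrow> ('k, 'a, 'y) module_scheme \<Rightarrow> 'a list \<Rightarrow> ('a list \<Rightarrow> 'k) set" where
  "pure_tensor K S as =
    tensor_kernel K S (length as) +>\<^bsub>tensor_free K S (length as)\<^esub> free_gen K as"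


section \<open>Linear maps given on homogeneous elements\<close>

definition linear_maps ::
    "('k, 'z) ring_scheme \<Rightarrow> ('k, 'b, 'y) module_scheme \<Rightarrow> ('k, 'c, 'x) module_scheme \<Rightarrow> ('b \<Rightarrow> 'c) set" where
  "linear_maps K M N =
    {f \<in> carrier M \<rightarrow> carrier N.
      (\<forall>x\<in>carrier M. \<forall>y\<in>carrier M. f (x \<oplus>\<^bsub>M\<^esub> y) = f x \<oplus>\<^bsub>N\<^esub> f y) \<and>
      (\<forall>c\<in>carrier K. \<forall>x\<in>carrier M. f (c \<odot>\<^bsub>M\<^esub> x) = c \<odot>\<^bsub>N\<^esub> f x)}"

text \<open>The linear map on the \<open>n\<close>-th tensor power of \<open>S\<close> whose value at a tensor product of
  homogeneous elements \<open>as\<close>, of parities \<open>es\<close>, is \<open>g as es\<close>. Passing the parities separately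
  avoids choosing a parity for zero, which is both even and odd. Restricting to extensional
  functions makes the map unique as a HOL function.\<close>

definition homogeneous_extension ::
    "('k, 'z) ring_scheme \<Rightarrow> ('k, 'a, 'y) superalgebra_scheme \<Rightarrow> nat \<Rightarrow> ('k, 'c, 'x) module_scheme \<Rightarrow>
      ('a list \<Rightarrow> bit list \<Rightarrow> 'c) \<Rightarrow> ('a list \<Rightarrow> 'k) set \<Rightarrow> 'c" where
  "homogeneous_extension K S n N g =
    (THE f. f \<in> linear_maps K (tensor_power K S n) N \<and>
            f \<in> extensional (carrier (tensor_power K S n)) \<and>
            (\<forall>as es. length as = n \<and> length es = n \<and> (\<forall>j<n. as ! j \<in> grade S (es ! j)) \<longrightarrow>
              f (pure_tensor K S as) = g as es))"


section \<open>The Hochschild complex of a superalgebra\<close>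

definition hochschild_chains ::
    "('k, 'z) ring_scheme \<Rightarrow> ('k, 'a, 'y) module_scheme \<Rightarrow> nat \<Rightarrow> ('k, ('a list \<Rightarrow> 'k) set) module" where
  "hochschild_chains K S m = tensor_power K S (m + 1)"

text \<open>Face maps and differential in degree \<open>m \<ge> 1\<close>. In degree 0 the target is the zero module;
  since \<open>0 - 1 = 0\<close> on \<^typ>\<open>nat\<close>, the differential in degree 0 is rendered as the zero map into
  the chains of degree 0.\<close>

definition hochschild_face ::
    "('k, 'z) ring_scheme \<Rightarrow> ('k, 'a, 'y) superalgebra_scheme \<Rightarrow> nat \<Rightarrow> nat \<Rightarrow>
      ('a list \<Rightarrow> 'k) set \<Rightarrow> ('a list \<Rightarrow> 'k) set" where
  "hochschild_face K S m i =
    homogeneous_extension K S (m + 1) (hochschild_chains K S (m - 1))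
      (\<lambda>as es.
        if i < m then pure_tensor K S (take i as @ [as ! i \<otimes>\<^bsub>S\<^esub> as ! (i + 1)] @ drop (i + 2) as)
        else parity_sign K (es ! m * (\<Sum>j<m. es ! j)) \<odot>\<^bsub>hochschild_chains K S (m - 1)\<^esub>
          pure_tensor K S ((as ! m \<otimes>\<^bsub>S\<^esub> as ! 0) # map (\<lambda>j. as ! j) [1..<m]))"

definition hochschild_diff ::
    "('k, 'z) ring_scheme \<Rightarrow> ('k, 'a, 'y) superalgebra_scheme \<Rightarrow> nat \<Rightarrow>
      ('a list \<Rightarrow> 'k) set \<Rightarrow> ('a list \<Rightarrow> 'k) set" where
  "hochschild_diff K S m t =
    (if m = 0 then \<zero>\<^bsub>hochschild_chains K S 0\<^esub>
     else \<Oplus>\<^bsub>hochschild_chains K S (m - 1)\<^esub>i\<in>{..m}.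
       ((\<ominus>\<^bsub>K\<^esub> \<one>\<^bsub>K\<^esub>) [^]\<^bsub>K\<^esub> i) \<odot>\<^bsub>hochschild_chains K S (m - 1)\<^esub> hochschild_face K S m i t)"


section \<open>The Dennis supertrace\<close>

text \<open>For an index list \<open>[i\<^sub>0, \<dots>, i\<^sub>m]\<close> this is
  \<open>A\<^sub>0(i\<^sub>0,i\<^sub>1) \<otimes> A\<^sub>1(i\<^sub>1,i\<^sub>2) \<otimes> \<dots> \<otimes> A\<^sub>m(i\<^sub>m,i\<^sub>0)\<close>.\<close>

definition cyclic_entry_tensor ::
    "('k, 'z) ring_scheme \<Rightarrow> ('k, 'a, 'y) module_scheme \<Rightarrow> nat \<Rightarrow> 'a mat list \<Rightarrow> nat list \<Rightarrow>
      ('a list \<Rightarrow> 'k) set" where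
  "cyclic_entry_tensor K R m As ix =
    pure_tensor K R (map (\<lambda>j. As ! j $$ (ix ! j, ix ! ((j + 1) mod (m + 1)))) [0..<m + 1])"

definition dennis_supertrace ::
    "('k, 'z) ring_scheme \<Rightarrow> ('k, 'a, 'y) superalgebra_scheme \<Rightarrow> nat \<Rightarrow> nat \<Rightarrow> nat \<Rightarrow>
      ('a mat list \<Rightarrow> 'k) set \<Rightarrow> ('a list \<Rightarrow> 'k) set" where
  "dennis_supertrace K R p q m =
    homogeneous_extension K (supermatrices R p q) (m + 1) (hochschild_chains K R m)
      (\<lambda>As es.
        (\<Oplus>\<^bsub>hochschild_chains K R m\<^esub>
            ix\<in>{ix. length ix = m + 1 \<and> set ix \<subseteq> {..<p + q} \<and> ix ! 0 < p}.
          cyclic_entry_tensor K R m As ix)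
        \<oplus>\<^bsub>hochschild_chains K R m\<^esub>
        parity_sign K (1 + (\<Sum>j\<le>m. es ! j)) \<odot>\<^bsub>hochschild_chains K R m\<^esub>
        (\<Oplus>\<^bsub>hochschild_chains K R m\<^esub>
            ix\<in>{ix. length ix = m + 1 \<and> set ix \<subseteq> {..<p + q} \<and> p \<le> ix ! 0}.
          cyclic_entry_tensor K R m As ix))"

end

theory Submission
  imports Defs
begin

text \<open>
  The supertrace commutes with each face map separately, \<open>\<delta>\<^sub>i \<circ> Str = Str \<circ> \<delta>\<^sub>i\<close>
  (\<open>hochschild_face_dennis_supertrace\<close>); the statement about the differential follows by taking
  the alternating sum.

  For homogeneous matrices the supertrace is the sum over all index lists \<open>i\<^sub>0, \<dots>, i\<^sub>m\<close> of the pure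
  tensors of the entries \<open>A\<^sub>j(i\<^sub>j, i\<^sub>j\<^sub>+\<^sub>1)\<close>, where the indices are cyclic, with sign exponent
  \<open>(1 + |A\<^sub>0| + \<dots> + |A\<^sub>m|) |i\<^sub>0|\<close>; here \<open>|i|\<close> is 0 or 1 according to the block of the index \<open>i\<close>.
  A face multiplies two cyclically adjacent factors. In the tensor of entries this gives one
  summand \<open>A\<^sub>i(i\<^sub>i, l) A\<^sub>i\<^sub>+\<^sub>1(l, i\<^sub>i\<^sub>+\<^sub>2)\<close> of the entry of the matrix product, and the sum over the
  index \<open>l\<close> completes it (\<open>pure_tensor_contract_cyclic_entries\<close>). For the inner faces no sign
  interferes. The last face moves an entry to the front. Its Koszul sign is computed from the
  parities \<open>|A\<^sub>j| + |i\<^sub>j| + |i\<^sub>j\<^sub>+\<^sub>1|\<close> of the entries instead of those of the matrices, and the leading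
  index becomes \<open>i\<^sub>m\<close> instead of \<open>i\<^sub>0\<close>. These two changes of sign cancel
  (\<open>face_sign_supertrace\<close>), which is the reason for the sign in the supertrace.

  The faces and the supertrace are specified only by their values at homogeneous pure tensors, so
  a preliminary part shows that such a specification determines a linear map. Existence follows
  from the universal property of the tensor power (\<open>tensor_power_universal\<close>): a
  prescription is extended to arbitrary letters by summing over all choices of even or odd components
  (\<open>homogeneous_extension_exists\<close>). Uniqueness holds because homogeneous pure tensors span
  (\<open>linear_maps_eqI_homogeneous\<close>).
\<close>

(* Parities are added, and their sums are rearranged, as elements of an additive group; the
   rewriting of these operations to bitwise ones would hide this structure. *)
declare add_bit_eq_xor [simp del] mult_bit_eq_and [simp del]

section \<open>Linear maps\<close>

lemma linear_mapsI:
  assumes "\<And>x. x \<in> carrier M \<Longrightarrow> f x \<in> carrier N"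
    and "\<And>x y. x \<in> carrier M \<Longrightarrow> y \<in> carrier M \<Longrightarrow> f (x \<oplus>\<^bsub>M\<^esub> y) = f x \<oplus>\<^bsub>N\<^esub> f y"
    and "\<And>c x. c \<in> carrier K \<Longrightarrow> x \<in> carrier M \<Longrightarrow> f (c \<odot>\<^bsub>M\<^esub> x) = c \<odot>\<^bsub>N\<^esub> f x"
  shows "f \<in> linear_maps K M N"
  using assms by (auto simp: linear_maps_def)

lemma linear_mapsD:
  assumes "f \<in> linear_maps K M N"
  shows "x \<in> carrier M \<Longrightarrow> f x \<in> carrier N"
    and "x \<in> carrier M \<Longrightarrow> y \<in> carrier M \<Longrightarrow> f (x \<oplus>\<^bsub>M\<^esub> y) = f x \<oplus>\<^bsub>N\<^esub> f y"
    and "c \<in> carrier K \<Longrightarrow> x \<in> carrier M \<Longrightarrow> f (c \<odot>\<^bsub>M\<^esub> x) = c \<odot>\<^bsub>N\<^esub> f x"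
  using assms by (auto simp: linear_maps_def)

lemma linear_maps_comp:
  "g \<in> linear_maps K N P \<Longrightarrow> f \<in> linear_maps K M N \<Longrightarrow> (\<lambda>x. g (f x)) \<in> linear_maps K M P"
  by (rule linear_mapsI) (simp_all add: linear_mapsD)

lemma linear_maps_cong:
  assumes "f \<in> linear_maps K M N" "\<And>x. x \<in> carrier M \<Longrightarrow> f x = g x"
    and "module K M"
  shows "g \<in> linear_maps K M N"
proof -
  interpret M: module K M by fact
  show ?thesis
    by (rule linear_mapsI) (simp_all flip: assms(2) add: linear_mapsD[OF assms(1)])
qed

lemma linear_maps_zero:
  assumes "module K M" "module K N" "f \<in> linear_maps K M N"
  shows "f \<zero>\<^bsub>M\<^esub> = \<zero>\<^bsub>N\<^esub>"
proof -
  interpret M: module K M by fact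
  interpret N: module K N by fact
  have "f (\<zero>\<^bsub>K\<^esub> \<odot>\<^bsub>M\<^esub> \<zero>\<^bsub>M\<^esub>) = \<zero>\<^bsub>K\<^esub> \<odot>\<^bsub>N\<^esub> f \<zero>\<^bsub>M\<^esub>"
    by (rule linear_mapsD(3)[OF assms(3)]) simp_all
  then show ?thesis
    using linear_mapsD(1)[OF assms(3), of "\<zero>\<^bsub>M\<^esub>"] by simp
qed

lemma linear_maps_finsum:
  assumes "module K M" "module K N" "f \<in> linear_maps K M N" "x \<in> I \<rightarrow> carrier M" "finite I"
  shows "f (\<Oplus>\<^bsub>M\<^esub>i\<in>I. x i) = (\<Oplus>\<^bsub>N\<^esub>i\<in>I. f (x i))"
proof -
  interpret M: module K M by fact
  interpret N: module K N by fact
  show ?thesis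
    using assms(5,4)
  proof (induction I rule: finite_induct)
    case empty
    then show ?case using linear_maps_zero[OF assms(1-3)] by simp
  next
    case (insert i I)
    then show ?case
      using linear_mapsD[OF assms(3)] by (simp add: Pi_def)
  qed
qed

text \<open>Commutativity of the ground ring enters here: it makes multiplication by a fixed scalar
  linear, so that differentials and signed sums of multilinear maps are again linear.\<close>

lemma linear_maps_lincomb:
  assumes "module K M" "module K N" "finite I" "\<And>i. i \<in> I \<Longrightarrow> c i \<in> carrier K"
    "\<And>i. i \<in> I \<Longrightarrow> f i \<in> linear_maps K M N"
  shows "(\<lambda>x. \<Oplus>\<^bsub>N\<^esub>i\<in>I. c i \<odot>\<^bsub>N\<^esub> f i x) \<in> linear_maps K M N"
proof -
  interpret M: module K M by fact
  interpret N: module K N by fact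
  note [simp] = assms(4) linear_mapsD[OF assms(5)]
  show ?thesis
  proof (rule linear_mapsI)
    fix x assume "x \<in> carrier M"
    then show "(\<Oplus>\<^bsub>N\<^esub>i\<in>I. c i \<odot>\<^bsub>N\<^esub> f i x) \<in> carrier N"
      by (intro N.finsum_closed) auto
  next
    fix x y assume xy: "x \<in> carrier M" "y \<in> carrier M"
    have "(\<Oplus>\<^bsub>N\<^esub>i\<in>I. c i \<odot>\<^bsub>N\<^esub> f i (x \<oplus>\<^bsub>M\<^esub> y)) = (\<Oplus>\<^bsub>N\<^esub>i\<in>I. c i \<odot>\<^bsub>N\<^esub> f i x \<oplus>\<^bsub>N\<^esub> c i \<odot>\<^bsub>N\<^esub> f i y)"
      using xy by (intro N.finsum_cong') (auto simp: N.smult_r_distr)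
    also have "\<dots> = (\<Oplus>\<^bsub>N\<^esub>i\<in>I. c i \<odot>\<^bsub>N\<^esub> f i x) \<oplus>\<^bsub>N\<^esub> (\<Oplus>\<^bsub>N\<^esub>i\<in>I. c i \<odot>\<^bsub>N\<^esub> f i y)"
      using xy by (intro N.finsum_addf) auto
    finally show "(\<Oplus>\<^bsub>N\<^esub>i\<in>I. c i \<odot>\<^bsub>N\<^esub> f i (x \<oplus>\<^bsub>M\<^esub> y)) = \<dots>" .
  next
    fix a x assume ax: "a \<in> carrier K" "x \<in> carrier M"
    have "(\<Oplus>\<^bsub>N\<^esub>i\<in>I. c i \<odot>\<^bsub>N\<^esub> f i (a \<odot>\<^bsub>M\<^esub> x)) = (\<Oplus>\<^bsub>N\<^esub>i\<in>I. a \<odot>\<^bsub>N\<^esub> (c i \<odot>\<^bsub>N\<^esub> f i x))"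
      using ax by (intro N.finsum_cong') (auto simp: M.R.m_comm simp flip: N.smult_assoc1)
    also have "\<dots> = a \<odot>\<^bsub>N\<^esub> (\<Oplus>\<^bsub>N\<^esub>i\<in>I. c i \<odot>\<^bsub>N\<^esub> f i x)"
      using ax assms(3) by (intro N.finsum_smult_ldistr[symmetric]) auto
    finally show "(\<Oplus>\<^bsub>N\<^esub>i\<in>I. c i \<odot>\<^bsub>N\<^esub> f i (a \<odot>\<^bsub>M\<^esub> x)) = \<dots>" .
  qed
qed

lemma linear_maps_finsum_pointwise:
  assumes M: "module K M" and N: "module K N" and I: "finite I"
    and f: "\<And>i. i \<in> I \<Longrightarrow> f i \<in> linear_maps K M N"
  shows "(\<lambda>x. \<Oplus>\<^bsub>N\<^esub>i\<in>I. f i x) \<in> linear_maps K M N"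
proof -
  interpret N: module K N by (fact N)
  have "(\<lambda>x. \<Oplus>\<^bsub>N\<^esub>i\<in>I. \<one>\<^bsub>K\<^esub> \<odot>\<^bsub>N\<^esub> f i x) \<in> linear_maps K M N"
    by (intro linear_maps_lincomb M N I f) auto
  then show ?thesis
    by (rule linear_maps_cong) (use linear_mapsD(1)[OF f] in \<open>auto intro!: N.finsum_cong' M\<close>)
qed

section \<open>Quotient modules and free modules\<close>

context
  fixes K :: "('k, 'z) ring_scheme" and M :: "('k, 'b, 'y) module_scheme" and H :: "'b set"
  assumes M: "module K M" and H: "submodule H K M"
begin

interpretation M: module K M by (fact M)
interpretation H: submodule H K M by (fact H)
interpretation H: abelian_subgroup H M
  by (intro abelian_subgroupI3 additive_subgroupI H.subgroup_axioms M.abelian_group_axioms)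

lemma carrier_quotient_module: "carrier (quotient_module M H) = (\<lambda>x. H +>\<^bsub>M\<^esub> x) ` carrier M"
  by (auto simp: quotient_module_def A_RCOSETS_def')

lemma quotient_add:
  "x \<in> carrier M \<Longrightarrow> y \<in> carrier M \<Longrightarrow>
    (H +>\<^bsub>M\<^esub> x) \<oplus>\<^bsub>quotient_module M H\<^esub> (H +>\<^bsub>M\<^esub> y) = H +>\<^bsub>M\<^esub> (x \<oplus>\<^bsub>M\<^esub> y)"
  by (simp add: quotient_module_def H.a_rcos_sum)

lemma quotient_coset_eq_iff:
  assumes "x \<in> carrier M" "y \<in> carrier M"
  shows "H +>\<^bsub>M\<^esub> x = H +>\<^bsub>M\<^esub> y \<longleftrightarrow> x \<ominus>\<^bsub>M\<^esub> y \<in> H"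
  using assms H.a_rcos_module[of y x] H.a_rcos_self[of x] H.a_repr_independence'[of x y]
  by (metis M.minus_eq)

lemma quotient_smult:
  assumes c: "c \<in> carrier K" and x: "x \<in> carrier M"
  shows "c \<odot>\<^bsub>quotient_module M H\<^esub> (H +>\<^bsub>M\<^esub> x) = H +>\<^bsub>M\<^esub> (c \<odot>\<^bsub>M\<^esub> x)"
proof -
  have "H +>\<^bsub>M\<^esub> (c \<odot>\<^bsub>M\<^esub> y) = H +>\<^bsub>M\<^esub> (c \<odot>\<^bsub>M\<^esub> x)" if y: "y \<in> H +>\<^bsub>M\<^esub> x" for y
  proof -
    have yM: "y \<in> carrier M" using y x H.a_elemrcos_carrier by blast
    then have "y \<ominus>\<^bsub>M\<^esub> x \<in> H"
      using y x H.a_rcos_module[of x y] by (simp add: M.minus_eq)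
    then have "c \<odot>\<^bsub>M\<^esub> (y \<ominus>\<^bsub>M\<^esub> x) \<in> H" using c by auto
    also have "c \<odot>\<^bsub>M\<^esub> (y \<ominus>\<^bsub>M\<^esub> x) = c \<odot>\<^bsub>M\<^esub> y \<ominus>\<^bsub>M\<^esub> c \<odot>\<^bsub>M\<^esub> x"
      using c x yM by (simp add: a_minus_def M.smult_r_distr M.smult_r_minus)
    finally show ?thesis using c x yM by (subst quotient_coset_eq_iff) auto
  qed
  moreover have "H +>\<^bsub>M\<^esub> x \<noteq> {}" using H.a_rcos_self x by blast
  ultimately show ?thesis by (simp add: quotient_module_def)
qed

lemma module_quotient: "module K (quotient_module M H)"
proof -
  note [simp] = carrier_quotient_module quotient_add quotient_smult
  have zero: "\<zero>\<^bsub>quotient_module M H\<^esub> = H +>\<^bsub>M\<^esub> \<zero>\<^bsub>M\<^esub>"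
    using H.a_subset by (simp add: quotient_module_def)
  show ?thesis
  proof (rule moduleI[OF M.R.cring_axioms abelian_groupI])
    fix X assume "X \<in> carrier (quotient_module M H)"
    then obtain x where x: "x \<in> carrier M" "X = H +>\<^bsub>M\<^esub> x" by auto
    show "\<exists>Y\<in>carrier (quotient_module M H). Y \<oplus>\<^bsub>quotient_module M H\<^esub> X = \<zero>\<^bsub>quotient_module M H\<^esub>"
      using x by (intro bexI[of _ "H +>\<^bsub>M\<^esub> (\<ominus>\<^bsub>M\<^esub> x)"]) (auto simp: zero M.l_neg)
  qed (auto simp: zero M.a_ac M.smult_l_distr M.smult_r_distr M.smult_assoc1)
qed

lemma linear_maps_coset: "(\<lambda>x. H +>\<^bsub>M\<^esub> x) \<in> linear_maps K M (quotient_module M H)"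
  by (rule linear_mapsI) (auto simp: carrier_quotient_module quotient_add quotient_smult)

text \<open>A map that kills \<open>H\<close> is constant on each coset, so its value at any chosen representative
  defines the induced map.\<close>

lemma linear_map_factors_through_quotient:
  assumes N: "module K N" and f: "f \<in> linear_maps K M N"
    and ker: "\<And>x. x \<in> H \<Longrightarrow> f x = \<zero>\<^bsub>N\<^esub>"
  shows "\<exists>g\<in>linear_maps K (quotient_module M H) N. \<forall>x\<in>carrier M. g (H +>\<^bsub>M\<^esub> x) = f x"
proof -
  interpret N: module K N by (fact N)
  note fD = linear_mapsD[OF f]
  have const: "f x = f y" if "x \<in> carrier M" "y \<in> carrier M" "H +>\<^bsub>M\<^esub> x = H +>\<^bsub>M\<^esub> y" for x y
  proof -
    have "x \<ominus>\<^bsub>M\<^esub> y \<in> H" using that quotient_coset_eq_iff by blast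
    then have "f ((x \<ominus>\<^bsub>M\<^esub> y) \<oplus>\<^bsub>M\<^esub> y) = \<zero>\<^bsub>N\<^esub> \<oplus>\<^bsub>N\<^esub> f y"
      using that ker fD by simp
    also have "(x \<ominus>\<^bsub>M\<^esub> y) \<oplus>\<^bsub>M\<^esub> y = x"
      using that by (simp add: M.minus_eq M.a_assoc M.l_neg)
    finally show ?thesis using that fD by simp
  qed
  define g where "g X = f (SOME x. x \<in> carrier M \<and> X = H +>\<^bsub>M\<^esub> x)" for X
  have g: "g (H +>\<^bsub>M\<^esub> x) = f x" if x: "x \<in> carrier M" for x
  proof -
    have *: "(SOME y. y \<in> carrier M \<and> H +>\<^bsub>M\<^esub> x = H +>\<^bsub>M\<^esub> y) \<in> carrier M \<and>
        H +>\<^bsub>M\<^esub> x = H +>\<^bsub>M\<^esub> (SOME y. y \<in> carrier M \<and> H +>\<^bsub>M\<^esub> x = H +>\<^bsub>M\<^esub> y)"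
      by (rule someI[of _ x]) (simp add: x)
    then show ?thesis unfolding g_def using const[OF x conjunct1[OF *] conjunct2[OF *]] by simp
  qed
  have "g \<in> linear_maps K (quotient_module M H) N"
    by (rule linear_mapsI) (auto simp: carrier_quotient_module quotient_add quotient_smult g fD)
  with g show ?thesis by blast
qed

end

lemma carrier_free_module:
  "f \<in> carrier (free_module K X) \<longleftrightarrow>
    (\<forall>x. f x \<in> carrier K) \<and> finite {x. f x \<noteq> \<zero>\<^bsub>K\<^esub>} \<and> {x. f x \<noteq> \<zero>\<^bsub>K\<^esub>} \<subseteq> X"
  by (simp add: free_module_def)

lemma free_module_simps [simp]:
  "\<zero>\<^bsub>free_module K X\<^esub> = (\<lambda>_. \<zero>\<^bsub>K\<^esub>)"
  "f \<oplus>\<^bsub>free_module K X\<^esub> g = (\<lambda>x. f x \<oplus>\<^bsub>K\<^esub> g x)"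
  "c \<odot>\<^bsub>free_module K X\<^esub> f = (\<lambda>x. c \<otimes>\<^bsub>K\<^esub> f x)"
  by (simp_all add: free_module_def)

lemma module_free_module:
  assumes "cring K"
  shows "module K (free_module K X)"
proof -
  interpret K: cring K by fact
  have add: "(\<lambda>x. f x \<oplus>\<^bsub>K\<^esub> g x) \<in> carrier (free_module K X)"
    if "f \<in> carrier (free_module K X)" "g \<in> carrier (free_module K X)" for f g
  proof -
    have "{x. f x \<oplus>\<^bsub>K\<^esub> g x \<noteq> \<zero>\<^bsub>K\<^esub>} \<subseteq> {x. f x \<noteq> \<zero>\<^bsub>K\<^esub>} \<union> {x. g x \<noteq> \<zero>\<^bsub>K\<^esub>}"
      by auto
    with that show ?thesis
      unfolding carrier_free_module by (auto intro: finite_subset[rotated])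
  qed
  have smult: "(\<lambda>x. c \<otimes>\<^bsub>K\<^esub> f x) \<in> carrier (free_module K X)"
    if "c \<in> carrier K" "f \<in> carrier (free_module K X)" for c f
  proof -
    have "{x. c \<otimes>\<^bsub>K\<^esub> f x \<noteq> \<zero>\<^bsub>K\<^esub>} \<subseteq> {x. f x \<noteq> \<zero>\<^bsub>K\<^esub>}"
      using that by auto
    with that show ?thesis
      unfolding carrier_free_module by (auto intro: finite_subset[rotated])
  qed
  have mem: "f x \<in> carrier K" if "f \<in> carrier (free_module K X)" for f x
    using that by (simp add: carrier_free_module)
  show ?thesis
  proof (rule moduleI[OF assms abelian_groupI])
    show "\<zero>\<^bsub>free_module K X\<^esub> \<in> carrier (free_module K X)"
      by (simp add: carrier_free_module)
  next
    fix f assume f: "f \<in> carrier (free_module K X)"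
    show "\<exists>g\<in>carrier (free_module K X). g \<oplus>\<^bsub>free_module K X\<^esub> f = \<zero>\<^bsub>free_module K X\<^esub>"
      using smult[of "\<ominus>\<^bsub>K\<^esub> \<one>\<^bsub>K\<^esub>", OF _ f] mem[OF f]
      by (intro bexI[of _ "\<lambda>x. \<ominus>\<^bsub>K\<^esub> \<one>\<^bsub>K\<^esub> \<otimes>\<^bsub>K\<^esub> f x"]) (auto simp: K.l_minus K.l_neg)
  qed (auto simp: add smult mem K.a_ac K.m_assoc K.l_distr K.r_distr)
qed

lemma free_gen_closed:
  assumes "cring K" "x \<in> X"
  shows "free_gen K x \<in> carrier (free_module K X)"
proof -
  interpret K: cring K by fact
  have "{y. free_gen K x y \<noteq> \<zero>\<^bsub>K\<^esub>} \<subseteq> {x}" by (auto simp: free_gen_def)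
  then show ?thesis using assms(2)
    by (auto simp: carrier_free_module free_gen_def intro: finite_subset)
qed

text \<open>A property of formal combinations is checked by splitting off one generator at a time, so
  the induction runs over a finite set containing the support.\<close>

lemma free_module_induct [consumes 2, case_names zero gen add smult]:
  assumes K: "cring K" and f: "f \<in> carrier (free_module K X)"
    and zero: "P \<zero>\<^bsub>free_module K X\<^esub>"
    and gen: "\<And>x. x \<in> X \<Longrightarrow> P (free_gen K x)"
    and add: "\<And>f g. f \<in> carrier (free_module K X) \<Longrightarrow> g \<in> carrier (free_module K X) \<Longrightarrow>
      P f \<Longrightarrow> P g \<Longrightarrow> P (f \<oplus>\<^bsub>free_module K X\<^esub> g)"
    and smult: "\<And>c f. c \<in> carrier K \<Longrightarrow> f \<in> carrier (free_module K X) \<Longrightarrow> P f \<Longrightarrow>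
      P (c \<odot>\<^bsub>free_module K X\<^esub> f)"
  shows "P f"
proof -
  interpret K: cring K by fact
  interpret F: module K "free_module K X" by (rule module_free_module[OF K])
  have "P f" if "finite B" "f \<in> carrier (free_module K X)" "{x. f x \<noteq> \<zero>\<^bsub>K\<^esub>} \<subseteq> B" "B \<subseteq> X" for B f
    using that
  proof (induction B arbitrary: f rule: finite_induct)
    case empty
    then have f0: "f = \<zero>\<^bsub>free_module K X\<^esub>" by auto
    show ?case unfolding f0 by (rule zero)
  next
    case (insert x B)
    let ?g = "\<lambda>y. if y = x then \<zero>\<^bsub>K\<^esub> else f y"
    have fK: "f y \<in> carrier K" for y using insert.prems(1) by (simp add: carrier_free_module)
    have supp: "{y. ?g y \<noteq> \<zero>\<^bsub>K\<^esub>} \<subseteq> {y. f y \<noteq> \<zero>\<^bsub>K\<^esub>}" by auto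
    have g: "?g \<in> carrier (free_module K X)"
      using insert.prems(1) finite_subset[OF supp] supp
      unfolding carrier_free_module by (metis (no_types, lifting) K.zero_closed subset_trans)
    have x: "x \<in> X" using insert.prems by simp
    have "P ?g" using insert.prems by (intro insert.IH g) auto
    then have "P (f x \<odot>\<^bsub>free_module K X\<^esub> free_gen K x \<oplus>\<^bsub>free_module K X\<^esub> ?g)"
      by (intro add smult gen F.smult_closed free_gen_closed K fK x g)
    also have "f x \<odot>\<^bsub>free_module K X\<^esub> free_gen K x \<oplus>\<^bsub>free_module K X\<^esub> ?g = f"
      using fK by (auto simp: free_gen_def)
    finally show ?case .
  qed
  from this[of "{x. f x \<noteq> \<zero>\<^bsub>K\<^esub>}" f] f show ?thesis by (simp add: carrier_free_module)
qed

lemma free_module_extension: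
  assumes N: "module K N" and \<phi>: "\<phi> \<in> X \<rightarrow> carrier N"
  shows "\<exists>f\<in>linear_maps K (free_module K X) N. \<forall>x\<in>X. f (free_gen K x) = \<phi> x"
proof -
  interpret N: module K N by (fact N)
  interpret F: module K "free_module K X" by (rule module_free_module) (rule N.R.cring_axioms)
  let ?supp = "\<lambda>f. {x. f x \<noteq> \<zero>\<^bsub>K\<^esub>}"
  define F where "F f = (\<Oplus>\<^bsub>N\<^esub>x\<in>?supp f. f x \<odot>\<^bsub>N\<^esub> \<phi> x)" for f
  have \<phi>N: "\<phi> x \<in> carrier N" if "x \<in> X" for x using \<phi> that by auto
  have F_eq: "F f = (\<Oplus>\<^bsub>N\<^esub>x\<in>B. f x \<odot>\<^bsub>N\<^esub> \<phi> x)"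
    if "f \<in> carrier (free_module K X)" "finite B" "?supp f \<subseteq> B" "B \<subseteq> X" for f B
    unfolding F_def using that
    by (intro N.add.finprod_mono_neutral_cong_left) (auto simp: carrier_free_module \<phi>N subset_iff)
  have "F \<in> linear_maps K (free_module K X) N"
  proof (rule linear_mapsI)
    fix f assume "f \<in> carrier (free_module K X)"
    then show "F f \<in> carrier N"
      unfolding F_def by (intro N.finsum_closed) (auto simp: carrier_free_module \<phi>N)
  next
    fix f g assume f: "f \<in> carrier (free_module K X)" and g: "g \<in> carrier (free_module K X)"
    let ?B = "?supp f \<union> ?supp g"
    note fg = f[unfolded carrier_free_module] g[unfolded carrier_free_module]
    have "F (f \<oplus>\<^bsub>free_module K X\<^esub> g) =
        (\<Oplus>\<^bsub>N\<^esub>x\<in>?B. (f \<oplus>\<^bsub>free_module K X\<^esub> g) x \<odot>\<^bsub>N\<^esub> \<phi> x)"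
      using f g fg by (intro F_eq F.a_closed) auto
    also have "\<dots> = (\<Oplus>\<^bsub>N\<^esub>x\<in>?B. f x \<odot>\<^bsub>N\<^esub> \<phi> x \<oplus>\<^bsub>N\<^esub> g x \<odot>\<^bsub>N\<^esub> \<phi> x)"
      using fg \<phi>N by (intro N.finsum_cong') (auto intro!: N.smult_l_distr)
    also have "\<dots> = (\<Oplus>\<^bsub>N\<^esub>x\<in>?B. f x \<odot>\<^bsub>N\<^esub> \<phi> x) \<oplus>\<^bsub>N\<^esub> (\<Oplus>\<^bsub>N\<^esub>x\<in>?B. g x \<odot>\<^bsub>N\<^esub> \<phi> x)"
      using fg \<phi>N by (intro N.finsum_addf) auto
    also have "\<dots> = F f \<oplus>\<^bsub>N\<^esub> F g"
      using fg f g by (intro arg_cong2[where f = "add N"] F_eq[symmetric]) auto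
    finally show "F (f \<oplus>\<^bsub>free_module K X\<^esub> g) = F f \<oplus>\<^bsub>N\<^esub> F g" .
  next
    fix c f assume c: "c \<in> carrier K" and f: "f \<in> carrier (free_module K X)"
    let ?B = "?supp f"
    note fc = f[unfolded carrier_free_module]
    have "F (c \<odot>\<^bsub>free_module K X\<^esub> f) = (\<Oplus>\<^bsub>N\<^esub>x\<in>?B. (c \<odot>\<^bsub>free_module K X\<^esub> f) x \<odot>\<^bsub>N\<^esub> \<phi> x)"
      using f c fc by (intro F_eq F.smult_closed) auto
    also have "\<dots> = (\<Oplus>\<^bsub>N\<^esub>x\<in>?B. c \<odot>\<^bsub>N\<^esub> (f x \<odot>\<^bsub>N\<^esub> \<phi> x))"
      using fc c \<phi>N by (intro N.finsum_cong') (auto intro!: N.smult_assoc1)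
    also have "\<dots> = c \<odot>\<^bsub>N\<^esub> F f"
      unfolding F_def using fc c \<phi>N by (intro N.finsum_smult_ldistr[symmetric]) auto
    finally show "F (c \<odot>\<^bsub>free_module K X\<^esub> f) = c \<odot>\<^bsub>N\<^esub> F f" .
  qed
  moreover have "F (free_gen K x) = \<phi> x" if x: "x \<in> X" for x
  proof -
    have "F (free_gen K x) = (\<Oplus>\<^bsub>N\<^esub>y\<in>{x}. free_gen K x y \<odot>\<^bsub>N\<^esub> \<phi> y)"
      using x by (intro F_eq free_gen_closed) (auto simp: free_gen_def N.R.cring_axioms)
    also have "\<dots> = \<phi> x"
      using \<phi>N[OF x] by (simp add: free_gen_def)
    finally show ?thesis .
  qed
  ultimately show ?thesis by blast
qed

section \<open>Tensor powers\<close>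

definition multilinear ::
    "('k, 'z) ring_scheme \<Rightarrow> ('k, 'a, 'y) module_scheme \<Rightarrow> nat \<Rightarrow> ('k, 'c, 'x) module_scheme \<Rightarrow>
      ('a list \<Rightarrow> 'c) \<Rightarrow> bool" where
  "multilinear K S n N \<phi> \<longleftrightarrow>
    (\<forall>as\<in>tensor_words S n. \<phi> as \<in> carrier N) \<and>
    (\<forall>as\<in>tensor_words S n. \<forall>i<n. (\<lambda>x. \<phi> (as[i := x])) \<in> linear_maps K S N)"

lemma multilinearD:
  assumes "multilinear K S n N \<phi>" "as \<in> tensor_words S n"
  shows "\<phi> as \<in> carrier N"
    and "i < n \<Longrightarrow> (\<lambda>x. \<phi> (as[i := x])) \<in> linear_maps K S N"
  using assms by (auto simp: multilinear_def)

lemma tensor_words_update: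
  "as \<in> tensor_words S n \<Longrightarrow> x \<in> carrier S \<Longrightarrow> as[i := x] \<in> tensor_words S n"
  by (auto simp: tensor_words_def dest: set_update_subset_insert[THEN subsetD])

lemma tensor_words_iff_nth:
  "as \<in> tensor_words S n \<longleftrightarrow> length as = n \<and> (\<forall>i<n. as ! i \<in> carrier S)"
  by (auto simp: tensor_words_def set_conv_nth)

lemma submodule_generated_submodule:
  assumes M: "module K M" and G: "G \<subseteq> carrier M"
  shows "submodule (generated_submodule K M G) K M" "G \<subseteq> generated_submodule K M G"
proof -
  interpret M: module K M by (fact M)
  let ?H = "generated_submodule K M G"
  have sub: "?H \<subseteq> carrier M"
    using G M.carrier_is_submodule by (auto simp: generated_submodule_def)
  have "submodule H K M \<Longrightarrow> \<zero>\<^bsub>M\<^esub> \<in> H" for H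
    using subgroup.one_closed[OF submodule.axioms(1)] by fastforce
  then show "submodule ?H K M"
    by (intro M.submoduleI[OF sub]) (auto simp: generated_submodule_def dest: M.submoduleE)
  show "G \<subseteq> ?H" by (auto simp: generated_submodule_def)
qed

lemma generated_submodule_minimal:
  "submodule H K M \<Longrightarrow> G \<subseteq> H \<Longrightarrow> generated_submodule K M G \<subseteq> H"
  by (auto simp: generated_submodule_def)

lemma submodule_linear_kernel:
  assumes M: "module K M" and N: "module K N" and f: "f \<in> linear_maps K M N"
  shows "submodule {x \<in> carrier M. f x = \<zero>\<^bsub>N\<^esub>} K M"
proof -
  interpret M: module K M by (fact M)
  interpret N: module K N by (fact N)
  note fD = linear_mapsD[OF f]
  have "f (\<ominus>\<^bsub>M\<^esub> x) = \<ominus>\<^bsub>N\<^esub> f x" if "x \<in> carrier M" for x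
    using that fD(3)[of "\<ominus>\<^bsub>K\<^esub> \<one>\<^bsub>K\<^esub>" x] fD(1)
    by (simp add: M.smult_l_minus N.smult_l_minus)
  then show ?thesis
    by (intro M.submoduleI) (auto simp: fD linear_maps_zero[OF M N f])
qed

context
  fixes K :: "('k, 'z) ring_scheme" and S :: "('k, 'a, 'y) module_scheme" and n :: nat
  assumes S: "module K S"
begin

interpretation S: module K S by (fact S)
interpretation F: module K "tensor_free K S n"
  unfolding tensor_free_def by (rule module_free_module) (rule S.R.cring_axioms)

lemma tensor_gen_closed: "as \<in> tensor_words S n \<Longrightarrow> free_gen K as \<in> carrier (tensor_free K S n)"
  unfolding tensor_free_def by (rule free_gen_closed) (rule S.R.cring_axioms)

lemma tensor_relations_closed: "tensor_relations K S n \<subseteq> carrier (tensor_free K S n)"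
  unfolding tensor_relations_def
  by (auto intro!: F.minus_closed F.a_closed F.smult_closed tensor_gen_closed tensor_words_update)

lemma submodule_tensor_kernel: "submodule (tensor_kernel K S n) K (tensor_free K S n)"
  and tensor_relations_subset_kernel: "tensor_relations K S n \<subseteq> tensor_kernel K S n"
  unfolding tensor_kernel_def
  by (intro submodule_generated_submodule F.module_axioms tensor_relations_closed)+

lemma module_tensor_power: "module K (tensor_power K S n)"
  unfolding tensor_power_def by (intro module_quotient F.module_axioms submodule_tensor_kernel)

lemma pure_tensor_eq:
  "as \<in> tensor_words S n \<Longrightarrow>
    pure_tensor K S as = tensor_kernel K S n +>\<^bsub>tensor_free K S n\<^esub> free_gen K as"
  by (simp add: pure_tensor_def tensor_words_def)

text \<open>The defining relations of the tensor power say exactly that the pure tensor depends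
  additively and homogeneously on each letter.\<close>

lemma multilinear_pure_tensor: "multilinear K S n (tensor_power K S n) (pure_tensor K S)"
proof -
  note sub = F.module_axioms submodule_tensor_kernel
  note coset = linear_mapsD[OF linear_maps_coset[OF sub], folded tensor_power_def]
  have rel: "tensor_kernel K S n +>\<^bsub>tensor_free K S n\<^esub> u = tensor_kernel K S n +>\<^bsub>tensor_free K S n\<^esub> v"
    if "u \<ominus>\<^bsub>tensor_free K S n\<^esub> v \<in> tensor_relations K S n"
      "u \<in> carrier (tensor_free K S n)" "v \<in> carrier (tensor_free K S n)" for u v
    using that tensor_relations_subset_kernel by (subst quotient_coset_eq_iff[OF sub]) auto
  show ?thesis
    unfolding multilinear_def
  proof (intro conjI ballI allI impI linear_mapsI)
    fix as assume "as \<in> tensor_words S n"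
    then show "pure_tensor K S as \<in> carrier (tensor_power K S n)"
      by (simp add: pure_tensor_eq coset tensor_gen_closed)
  next
    fix as i x assume "as \<in> tensor_words S n" "x \<in> carrier S"
    then show "pure_tensor K S (as[i := x]) \<in> carrier (tensor_power K S n)"
      by (simp add: pure_tensor_eq tensor_words_update coset tensor_gen_closed)
  next
    fix as i x y assume *: "as \<in> tensor_words S n" "i < n" "x \<in> carrier S" "y \<in> carrier S"
    note w = tensor_words_update[OF *(1)]
    show "pure_tensor K S (as[i := x \<oplus>\<^bsub>S\<^esub> y]) =
        pure_tensor K S (as[i := x]) \<oplus>\<^bsub>tensor_power K S n\<^esub> pure_tensor K S (as[i := y])"
      unfolding pure_tensor_eq[OF w, OF S.a_closed[OF *(3,4)]] pure_tensor_eq[OF w, OF *(3)]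
        pure_tensor_eq[OF w, OF *(4)] coset(2)[OF tensor_gen_closed tensor_gen_closed,
          OF w w, OF *(3,4), symmetric]
      using * by (intro rel F.a_closed tensor_gen_closed w)
        (auto simp: tensor_relations_def)
  next
    fix as i c x assume *: "as \<in> tensor_words S n" "i < n" "c \<in> carrier K" "x \<in> carrier S"
    note w = tensor_words_update[OF *(1)]
    show "pure_tensor K S (as[i := c \<odot>\<^bsub>S\<^esub> x]) = c \<odot>\<^bsub>tensor_power K S n\<^esub> pure_tensor K S (as[i := x])"
      unfolding pure_tensor_eq[OF w, OF S.smult_closed[OF *(3,4)]] pure_tensor_eq[OF w, OF *(4)]
        coset(3)[OF *(3) tensor_gen_closed, OF w, OF *(4), symmetric]
      using * by (intro rel F.smult_closed tensor_gen_closed w)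
        (auto simp: tensor_relations_def)
  qed
qed

lemma pure_tensor_closed:
  "as \<in> tensor_words S n \<Longrightarrow> pure_tensor K S as \<in> carrier (tensor_power K S n)"
  using multilinear_pure_tensor by (rule multilinearD)

text \<open>Pure tensors span the tensor power, being the images of the generators of the free module.\<close>

lemma linear_maps_eqI_pure:
  assumes N: "module K N"
    and f: "f \<in> linear_maps K (tensor_power K S n) N" and g: "g \<in> linear_maps K (tensor_power K S n) N"
    and eq: "\<And>as. as \<in> tensor_words S n \<Longrightarrow> f (pure_tensor K S as) = g (pure_tensor K S as)"
    and t: "t \<in> carrier (tensor_power K S n)"
  shows "f t = g t"
proof -
  interpret N: module K N by (fact N)
  let ?q = "\<lambda>u. tensor_kernel K S n +>\<^bsub>tensor_free K S n\<^esub> u"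
  note sub = F.module_axioms submodule_tensor_kernel
  have q: "?q \<in> linear_maps K (free_module K (tensor_words S n)) (tensor_power K S n)"
    using linear_maps_coset[OF sub] unfolding tensor_power_def tensor_free_def .
  note lin = linear_maps_comp[OF f q] linear_maps_comp[OF g q]
  note fD = linear_mapsD[OF lin(1)] and gD = linear_mapsD[OF lin(2)]
  obtain u where u: "u \<in> carrier (free_module K (tensor_words S n))" "t = ?q u"
    using t unfolding tensor_power_def carrier_quotient_module[OF sub] by (auto simp: tensor_free_def)
  have "f (?q u) = g (?q u)"
    using S.R.cring_axioms u(1)
  proof (induction u rule: free_module_induct)
    case zero
    show ?case
      using linear_maps_zero[OF F.module_axioms N] lin unfolding tensor_free_def by metis
  next
    case (gen as)
    then show ?case using eq[of as] by (simp add: pure_tensor_eq)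
  next
    case (add u v)
    then show ?case by (simp only: fD(2) gD(2))
  next
    case (smult c u)
    then show ?case by (simp only: fD(3) gD(3))
  qed
  then show ?thesis using u by simp
qed

text \<open>The linear extension of a multilinear map to the free module kills each defining relation;
  its kernel is a submodule, so it contains everything that the relations generate.\<close>

lemma tensor_power_universal:
  assumes N: "module K N" and \<phi>: "multilinear K S n N \<phi>"
  shows "\<exists>f\<in>linear_maps K (tensor_power K S n) N. \<forall>as\<in>tensor_words S n. f (pure_tensor K S as) = \<phi> as"
proof -
  interpret N: module K N by (fact N)
  note \<phi>D = multilinearD[OF \<phi>]
  have "\<phi> \<in> tensor_words S n \<rightarrow> carrier N" using \<phi>D by auto
  from free_module_extension[OF N this]
  obtain h where h: "h \<in> linear_maps K (tensor_free K S n) N"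
    and h_gen: "\<And>as. as \<in> tensor_words S n \<Longrightarrow> h (free_gen K as) = \<phi> as"
    unfolding tensor_free_def by blast
  note hD = linear_mapsD[OF h]
  have h_minus: "h (u \<ominus>\<^bsub>tensor_free K S n\<^esub> v) = \<zero>\<^bsub>N\<^esub>"
    if "u \<in> carrier (tensor_free K S n)" "v \<in> carrier (tensor_free K S n)" "h u = h v" for u v
    using that hD(3)[of "\<ominus>\<^bsub>K\<^esub> \<one>\<^bsub>K\<^esub>" v] hD(1)
    by (simp add: F.minus_eq hD(2) F.smult_l_minus N.smult_l_minus N.r_neg)
  let ?ker = "{u \<in> carrier (tensor_free K S n). h u = \<zero>\<^bsub>N\<^esub>}"
  have "tensor_relations K S n \<subseteq> ?ker"
  proof (intro subsetI CollectI conjI)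
    fix u assume u: "u \<in> tensor_relations K S n"
    then show "u \<in> carrier (tensor_free K S n)" using tensor_relations_closed by blast
    show "h u = \<zero>\<^bsub>N\<^esub>"
      using u unfolding tensor_relations_def
      by (elim UnE CollectE exE conjE)
        (simp_all add: h_minus F.a_closed tensor_gen_closed tensor_words_update hD h_gen
          linear_mapsD[OF \<phi>D(2)])
  qed
  then have "tensor_kernel K S n \<subseteq> ?ker"
    unfolding tensor_kernel_def
    by (intro generated_submodule_minimal submodule_linear_kernel F.module_axioms N h)
  then obtain g where "g \<in> linear_maps K (tensor_power K S n) N"
    and "\<And>u. u \<in> carrier (tensor_free K S n) \<Longrightarrow>
      g (tensor_kernel K S n +>\<^bsub>tensor_free K S n\<^esub> u) = h u"
    using linear_map_factors_through_quotient[OF F.module_axioms submodule_tensor_kernel N h]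
    unfolding tensor_power_def by blast
  then show ?thesis
    by (intro bexI[of _ g]) (auto simp: pure_tensor_eq tensor_gen_closed h_gen)
qed

end

lemma multilinear_cong:
  assumes "multilinear K S n N \<phi>" "\<And>as. as \<in> tensor_words S n \<Longrightarrow> \<phi> as = \<psi> as" "module K S"
  shows "multilinear K S n N \<psi>"
  unfolding multilinear_def
proof (intro conjI ballI allI impI)
  fix as i assume as: "as \<in> tensor_words S n" "i < n"
  show "(\<lambda>x. \<psi> (as[i := x])) \<in> linear_maps K S N"
    by (rule linear_maps_cong[OF multilinearD(2)[OF assms(1) as]])
      (simp_all add: assms(2,3) tensor_words_update as)
qed (use multilinearD(1)[OF assms(1)] assms(2) in auto)

lemma multilinear_lincomb:
  assumes S: "module K S" and N: "module K N" and "finite I"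
    and c: "\<And>i. i \<in> I \<Longrightarrow> c i \<in> carrier K"
    and \<phi>: "\<And>i. i \<in> I \<Longrightarrow> multilinear K S n N (\<phi> i)"
  shows "multilinear K S n N (\<lambda>as. \<Oplus>\<^bsub>N\<^esub>i\<in>I. c i \<odot>\<^bsub>N\<^esub> \<phi> i as)"
proof -
  interpret N: module K N by (fact N)
  show ?thesis
    unfolding multilinear_def
    using multilinearD[OF \<phi>] c \<open>finite I\<close>
    by (auto intro!: N.finsum_closed linear_maps_lincomb S N)
qed

lemma multilinear_smult:
  assumes S: "module K S" and N: "module K N" and c: "c \<in> carrier K" and \<phi>: "multilinear K S n N \<phi>"
  shows "multilinear K S n N (\<lambda>as. c \<odot>\<^bsub>N\<^esub> \<phi> as)"
proof -
  interpret N: module K N by (fact N)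
  show ?thesis
    unfolding multilinear_def
  proof (intro conjI ballI allI impI)
    fix as i assume "as \<in> tensor_words S n" "i < n"
    note D = linear_mapsD[OF multilinearD(2)[OF \<phi> this]]
    show "(\<lambda>x. c \<odot>\<^bsub>N\<^esub> \<phi> (as[i := x])) \<in> linear_maps K S N"
      using c by (intro linear_mapsI)
        (simp_all add: D N.smult_r_distr N.R.m_comm flip: N.smult_assoc1)
  qed (use multilinearD(1)[OF \<phi>] c in auto)
qed

text \<open>The word maps below either multiply two adjacent letters or apply a linear map, such as a
  homogeneous component or a matrix entry, to each letter. In both cases a change of one letter
  changes one letter of the result, and it does so linearly.\<close>

lemma multilinear_slotwise_linear:
  assumes \<phi>: "multilinear K S' n' N \<phi>"
    and W: "\<And>as. as \<in> tensor_words S n \<Longrightarrow> W as \<in> tensor_words S' n'"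
    and slot: "\<And>as i. as \<in> tensor_words S n \<Longrightarrow> i < n \<Longrightarrow>
      \<exists>j<n'. \<exists>L\<in>linear_maps K S S'. \<forall>x\<in>carrier S. W (as[i := x]) = (W as)[j := L x]"
    and S: "module K S"
  shows "multilinear K S n N (\<lambda>as. \<phi> (W as))"
  unfolding multilinear_def
proof (intro conjI ballI allI impI)
  fix as i assume as: "as \<in> tensor_words S n" "i < n"
  obtain j L where j: "j < n'" and L: "L \<in> linear_maps K S S'"
    and eq: "\<And>x. x \<in> carrier S \<Longrightarrow> W (as[i := x]) = (W as)[j := L x]"
    using slot[OF as] by blast
  from multilinearD(2)[OF \<phi> W[OF as(1)] j] L
  have "(\<lambda>x. \<phi> ((W as)[j := L x])) \<in> linear_maps K S N"
    by (rule linear_maps_comp)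
  then show "(\<lambda>x. \<phi> (W (as[i := x]))) \<in> linear_maps K S N"
    by (rule linear_maps_cong) (simp_all add: eq S)
qed (use multilinearD(1)[OF \<phi>] W in auto)

lemma multilinear_zero:
  assumes S: "module K S" and N: "module K N" and \<phi>: "multilinear K S n N \<phi>"
    and as: "as \<in> tensor_words S n" and i: "i < n" "as ! i = \<zero>\<^bsub>S\<^esub>"
  shows "\<phi> as = \<zero>\<^bsub>N\<^esub>"
  using linear_maps_zero[OF S N multilinearD(2)[OF \<phi> as i(1)]] i(2) list_update_id[of as i] by simp

section \<open>Graded modules\<close>

locale graded_module = module K S
  for K :: "('k, 'z) ring_scheme" (structure)
    and S :: "('k, 'a, 'y) superalgebra_scheme" (structure) +
  assumes grade_submodule: "submodule (grade S e) K S"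
    and grade_sum: "x \<in> carrier S \<Longrightarrow> \<exists>a\<in>grade S 0. \<exists>b\<in>grade S 1. x = a \<oplus>\<^bsub>S\<^esub> b"
    and grade_inter: "grade S 0 \<inter> grade S 1 = {\<zero>\<^bsub>S\<^esub>}"
begin

lemma bit_not_eq_iff: "(e :: bit) \<noteq> e' \<longleftrightarrow> e' = e + 1"
  by (cases e; cases e') auto

lemma grade_closed: "x \<in> grade S e \<Longrightarrow> x \<in> carrier S"
  using submoduleE(1)[OF grade_submodule] by blast

lemmas grade_add = submoduleE(5)[OF grade_submodule]
lemmas grade_smult = submoduleE(4)[OF grade_submodule]
lemmas grade_uminus = submoduleE(3)[OF grade_submodule]

lemma grade_zero: "\<zero>\<^bsub>S\<^esub> \<in> grade S e"
  using grade_inter by (cases e) auto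

lemma grade_decomposition:
  assumes "x \<in> carrier S"
  shows "\<exists>a\<in>grade S e. \<exists>b\<in>grade S (e + 1). x = a \<oplus>\<^bsub>S\<^esub> b"
proof -
  obtain a b where ab: "a \<in> grade S 0" "b \<in> grade S 1" "x = a \<oplus>\<^bsub>S\<^esub> b"
    using grade_sum[OF assms] by blast
  have ba: "x = b \<oplus>\<^bsub>S\<^esub> a" using ab by (simp add: M.a_comm grade_closed)
  show ?thesis
  proof (cases e)
    case zero
    then show ?thesis using ab by auto
  next
    case one
    then show ?thesis using ab(1,2) ba by auto
  qed
qed

lemma grade_decomposition_unique:
  assumes "a \<in> grade S e" "b \<in> grade S (e + 1)" "a' \<in> grade S e" "b' \<in> grade S (e + 1)"
    and eq: "a \<oplus>\<^bsub>S\<^esub> b = a' \<oplus>\<^bsub>S\<^esub> b'"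
  shows "a = a'"
proof -
  note car = assms(1-4)[THEN grade_closed]
  have "a \<oplus>\<^bsub>S\<^esub> \<ominus>\<^bsub>S\<^esub> a' = b' \<oplus>\<^bsub>S\<^esub> \<ominus>\<^bsub>S\<^esub> b"
  proof -
    have "a = (a' \<oplus>\<^bsub>S\<^esub> b') \<oplus>\<^bsub>S\<^esub> \<ominus>\<^bsub>S\<^esub> b"
      unfolding eq[symmetric] using car by (simp add: M.a_assoc M.r_neg)
    then have "a \<oplus>\<^bsub>S\<^esub> \<ominus>\<^bsub>S\<^esub> a' = ((a' \<oplus>\<^bsub>S\<^esub> b') \<oplus>\<^bsub>S\<^esub> \<ominus>\<^bsub>S\<^esub> b) \<oplus>\<^bsub>S\<^esub> \<ominus>\<^bsub>S\<^esub> a'"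
      by simp
    also have "\<dots> = (b' \<oplus>\<^bsub>S\<^esub> \<ominus>\<^bsub>S\<^esub> b) \<oplus>\<^bsub>S\<^esub> (a' \<oplus>\<^bsub>S\<^esub> \<ominus>\<^bsub>S\<^esub> a')"
      using car by (simp add: M.a_ac)
    also have "\<dots> = b' \<oplus>\<^bsub>S\<^esub> \<ominus>\<^bsub>S\<^esub> b"
      using car by (simp add: M.r_neg)
    finally show ?thesis .
  qed
  moreover have "a \<oplus>\<^bsub>S\<^esub> \<ominus>\<^bsub>S\<^esub> a' \<in> grade S e" "b' \<oplus>\<^bsub>S\<^esub> \<ominus>\<^bsub>S\<^esub> b \<in> grade S (e + 1)"
    using assms grade_add grade_uminus by auto
  ultimately have "a \<oplus>\<^bsub>S\<^esub> \<ominus>\<^bsub>S\<^esub> a' \<in> grade S 0 \<inter> grade S 1"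
    by (cases e) auto
  then have "a \<oplus>\<^bsub>S\<^esub> \<ominus>\<^bsub>S\<^esub> a' = \<zero>\<^bsub>S\<^esub>" using grade_inter by simp
  then show ?thesis using car using M.minus_equality[of a "\<ominus>\<^bsub>S\<^esub> a'"] by simp
qed

text \<open>The choice operator picks the summand of parity \<open>e\<close>; it is unique by the preceding lemma.\<close>

definition component :: "bit \<Rightarrow> 'a \<Rightarrow> 'a" where
  "component e x = (SOME a. a \<in> grade S e \<and> (\<exists>b\<in>grade S (e + 1). x = a \<oplus>\<^bsub>S\<^esub> b))"

lemma component_eqI:
  assumes "a \<in> grade S e" "b \<in> grade S (e + 1)" "x = a \<oplus>\<^bsub>S\<^esub> b"
  shows "component e x = a"
  unfolding component_def using assms grade_decomposition_unique
  by (intro some_equality) auto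

lemma
  assumes "x \<in> carrier S"
  shows component_grade: "component e x \<in> grade S e"
    and component_sum: "x = component e x \<oplus>\<^bsub>S\<^esub> component (e + 1) x"
proof -
  obtain a b where ab: "a \<in> grade S e" "b \<in> grade S (e + 1)" "x = a \<oplus>\<^bsub>S\<^esub> b"
    using grade_decomposition[OF assms] by blast
  have "e + 1 + 1 = e" by (cases e) auto
  then have "component (e + 1) x = b"
    using ab M.a_comm grade_closed by (intro component_eqI[of b _ a]) auto
  then show "component e x \<in> grade S e" "x = component e x \<oplus>\<^bsub>S\<^esub> component (e + 1) x"
    using ab component_eqI[OF ab] by auto
qed

lemma component_linear: "component e \<in> linear_maps K S S"
proof (rule linear_mapsI)
  fix x assume "x \<in> carrier S"
  then show "component e x \<in> carrier S" using component_grade grade_closed by blast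
next
  fix x y assume x: "x \<in> carrier S" and y: "y \<in> carrier S"
  from grade_decomposition[OF x]
  obtain a b where a: "a \<in> grade S e" "b \<in> grade S (e + 1)" "x = a \<oplus>\<^bsub>S\<^esub> b"
    by blast
  from grade_decomposition[OF y]
  obtain a' b' where a': "a' \<in> grade S e" "b' \<in> grade S (e + 1)" "y = a' \<oplus>\<^bsub>S\<^esub> b'"
    by blast
  have "x \<oplus>\<^bsub>S\<^esub> y = (a \<oplus>\<^bsub>S\<^esub> a') \<oplus>\<^bsub>S\<^esub> (b \<oplus>\<^bsub>S\<^esub> b')"
    using a a' grade_closed by (simp add: M.a_ac)
  then show "component e (x \<oplus>\<^bsub>S\<^esub> y) = component e x \<oplus>\<^bsub>S\<^esub> component e y"
    using component_eqI[OF grade_add[OF a(1) a'(1)] grade_add[OF a(2) a'(2)]]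
      component_eqI[OF a] component_eqI[OF a'] by simp
next
  fix c x assume c: "c \<in> carrier K" and "x \<in> carrier S"
  then obtain a b where a: "a \<in> grade S e" "b \<in> grade S (e + 1)" "x = a \<oplus>\<^bsub>S\<^esub> b"
    using grade_decomposition by blast
  have "c \<odot>\<^bsub>S\<^esub> x = c \<odot>\<^bsub>S\<^esub> a \<oplus>\<^bsub>S\<^esub> c \<odot>\<^bsub>S\<^esub> b"
    using a c grade_closed by (simp add: smult_r_distr)
  then show "component e (c \<odot>\<^bsub>S\<^esub> x) = c \<odot>\<^bsub>S\<^esub> component e x"
    using component_eqI[OF grade_smult[OF c a(1)] grade_smult[OF c a(2)]]
      component_eqI[OF a] by simp
qed

lemma component_homogeneous:
  assumes "x \<in> grade S e'"
  shows "component e x = (if e = e' then x else \<zero>\<^bsub>S\<^esub>)"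
proof (cases "e = e'")
  case True
  then show ?thesis
    using assms grade_zero grade_closed by (auto intro!: component_eqI[where b = "\<zero>\<^bsub>S\<^esub>"])
next
  case False
  then have "e' = e + 1" by (simp add: bit_not_eq_iff)
  then show ?thesis
    using assms grade_zero grade_closed False by (auto intro!: component_eqI[where b = x])
qed

definition homogeneous_word :: "nat \<Rightarrow> 'a list \<Rightarrow> bit list \<Rightarrow> bool" where
  "homogeneous_word n as es \<longleftrightarrow> length as = n \<and> length es = n \<and> (\<forall>j<n. as ! j \<in> grade S (es ! j))"

lemma homogeneous_word_in_tensor_words: "homogeneous_word n as es \<Longrightarrow> as \<in> tensor_words S n"
  by (auto simp: homogeneous_word_def tensor_words_iff_nth grade_closed)

text \<open>Splitting one letter after the other into its even and its odd part reduces an arbitrary pure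
  tensor to homogeneous ones: in the induction, the letters from position \<open>k\<close> on are already
  homogeneous.\<close>

lemma linear_maps_eqI_homogeneous:
  assumes N: "module K N"
    and f: "f \<in> linear_maps K (tensor_power K S n) N" and g: "g \<in> linear_maps K (tensor_power K S n) N"
    and eq: "\<And>as es. homogeneous_word n as es \<Longrightarrow> f (pure_tensor K S as) = g (pure_tensor K S as)"
    and t: "t \<in> carrier (tensor_power K S n)"
  shows "f t = g t"
proof (rule linear_maps_eqI_pure[OF module_axioms N f g _ t])
  note pure = multilinearD[OF multilinear_pure_tensor[OF module_axioms]]
  note fD = linear_mapsD[OF linear_maps_comp[OF f pure(2)]]
    and gD = linear_mapsD[OF linear_maps_comp[OF g pure(2)]]
  have split: "f (pure_tensor K S as) = g (pure_tensor K S as)"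
    if "k \<le> n" "as \<in> tensor_words S n" "\<forall>j\<in>{k..<n}. \<exists>e. as ! j \<in> grade S e" for k as
    using that
  proof (induction k arbitrary: as)
    case 0
    then obtain e where "\<forall>j\<in>{0..<n}. as ! j \<in> grade S (e j)" by metis
    then have "homogeneous_word n as (map e [0..<n])"
      using 0 by (auto simp: homogeneous_word_def tensor_words_def)
    then show ?case by (rule eq)
  next
    case (Suc k)
    have k: "k < n" "as ! k \<in> carrier S" "length as = n"
      using Suc.prems by (auto simp: tensor_words_iff_nth)
    obtain a b where ab: "a \<in> grade S 0" "b \<in> grade S 1" "as ! k = a \<oplus>\<^bsub>S\<^esub> b"
      using grade_sum[OF k(2)] by blast
    note car = ab(1,2)[THEN grade_closed]
    have IH: "f (pure_tensor K S (as[k := x])) = g (pure_tensor K S (as[k := x]))"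
      if "x \<in> grade S e" for x e
    proof (rule Suc.IH)
      show "\<forall>j\<in>{k..<n}. \<exists>e. as[k := x] ! j \<in> grade S e"
        using Suc.prems(3) that k by (auto simp: nth_list_update)
    qed (use Suc.prems tensor_words_update[OF _ grade_closed[OF that]] in auto)
    have "as = as[k := a \<oplus>\<^bsub>S\<^esub> b]" using ab by (metis list_update_id)
    then show ?case
      using fD(2)[OF Suc.prems(2) k(1) car] gD(2)[OF Suc.prems(2) k(1) car]
        IH[OF ab(1)] IH[OF ab(2)] by simp
  qed
  show "f (pure_tensor K S as) = g (pure_tensor K S as)" if "as \<in> tensor_words S n" for as
    using split[of n as] that by simp
qed

text \<open>The parity lists are summed over because a letter has both an even and an odd component. At
  a homogeneous word every term but the intended one contains the letter zero, so the
  prescribed value comes out even where a letter zero makes the parity list ambiguous.\<close>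

lemma homogeneous_extension_exists:
  assumes N: "module K N"
    and g: "\<And>es. length es = n \<Longrightarrow> multilinear K S n N (\<lambda>as. g as es)"
  shows "\<exists>f\<in>linear_maps K (tensor_power K S n) N. \<forall>as es. homogeneous_word n as es \<longrightarrow>
    f (pure_tensor K S as) = g as es"
proof -
  interpret N: module K N by (fact N)
  define E where "E = {es :: bit list. length es = n}"
  have "(UNIV :: bit set) = {0, 1}" by (auto intro: bit.exhaust)
  then have "finite (UNIV :: bit set)" by (metis finite.emptyI finite.insertI)
  then have E: "finite E"
    using finite_lists_length_eq[of "UNIV :: bit set" n] by (simp add: E_def)
  define W where "W es as = map (\<lambda>j. component (es ! j) (as ! j)) [0..<n]" for es as
  have W: "W es as \<in> tensor_words S n" if "as \<in> tensor_words S n" for as es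
    using that linear_mapsD(1)[OF component_linear] by (auto simp: W_def tensor_words_iff_nth)
  have W_slot: "W es (as[i := x]) = (W es as)[i := component (es ! i) x]"
    if "as \<in> tensor_words S n" "i < n" for es as i x
    using that by (auto simp: W_def tensor_words_def nth_list_update intro!: nth_equalityI)
  have gW: "multilinear K S n N (\<lambda>as. g (W es as) es)" if "es \<in> E" for es
    using that W W_slot component_linear
    by (intro multilinear_slotwise_linear[OF g _ _ module_axioms]) (auto simp: E_def intro!: exI bexI)
  have "multilinear K S n N (\<lambda>as. \<Oplus>\<^bsub>N\<^esub>es\<in>E. \<one>\<^bsub>K\<^esub> \<odot>\<^bsub>N\<^esub> g (W es as) es)"
    by (intro multilinear_lincomb module_axioms N E gW) auto
  from tensor_power_universal[OF module_axioms N this]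
  obtain f where f: "f \<in> linear_maps K (tensor_power K S n) N"
    and f_pure: "\<And>as. as \<in> tensor_words S n \<Longrightarrow>
      f (pure_tensor K S as) = (\<Oplus>\<^bsub>N\<^esub>es\<in>E. \<one>\<^bsub>K\<^esub> \<odot>\<^bsub>N\<^esub> g (W es as) es)"
    by blast
  have "f (pure_tensor K S as) = g as es" if h: "homogeneous_word n as es" for as es
  proof -
    have as: "as \<in> tensor_words S n" by (rule homogeneous_word_in_tensor_words[OF h])
    have es: "es \<in> E" using h by (simp add: E_def homogeneous_word_def)
    have comp: "W es' as ! j = (if es' ! j = es ! j then as ! j else \<zero>\<^bsub>S\<^esub>)" if "j < n" for es' j
      using that h by (simp add: W_def homogeneous_word_def component_homogeneous)
    have W_es: "W es as = as"
      using h comp[of _ es] by (intro nth_equalityI) (auto simp: homogeneous_word_def W_def)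
    have closed: "g (W es' as) es' \<in> carrier N" if "es' \<in> E" for es'
      using multilinearD(1)[OF gW[OF that] as] .
    have vanish: "g (W es' as) es' = \<zero>\<^bsub>N\<^esub>" if es': "es' \<in> E" "es' \<noteq> es" for es'
    proof -
      obtain j where j: "j < n" "es' ! j \<noteq> es ! j"
        using es es' by (auto simp: E_def list_eq_iff_nth_eq)
      show ?thesis
        using es' j comp[OF j(1)] by (intro multilinear_zero[OF module_axioms N g W[OF as] j(1)])
          (auto simp: E_def)
    qed
    have "f (pure_tensor K S as) = (\<Oplus>\<^bsub>N\<^esub>es'\<in>E. if es' = es then g (W es' as) es' else \<zero>\<^bsub>N\<^esub>)"
      unfolding f_pure[OF as] using closed vanish by (intro N.finsum_cong') auto
    also have "\<dots> = g (W es as) es"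
      using closed by (intro N.add.finprod_singleton_swap es E) auto
    finally show ?thesis by (simp add: W_es)
  qed
  with f show ?thesis by blast
qed

text \<open>A definition by \<open>homogeneous_extension\<close> is thus meaningful as soon as its formula is
  multilinear in the letters for each fixed list of parities. The faces and the supertrace have
  such a formula, because parities occur in them only through signs.\<close>

lemma homogeneous_extension:
  assumes N: "module K N"
    and g: "\<And>es. length es = n \<Longrightarrow> multilinear K S n N (\<lambda>as. g as es)"
  shows "homogeneous_extension K S n N g \<in> linear_maps K (tensor_power K S n) N"
    and "homogeneous_word n as es \<Longrightarrow> homogeneous_extension K S n N g (pure_tensor K S as) = g as es"
proof -
  let ?T = "tensor_power K S n"
  let ?P = "\<lambda>f. f \<in> linear_maps K ?T N \<and> f \<in> extensional (carrier ?T) \<and>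
    (\<forall>as es. length as = n \<and> length es = n \<and> (\<forall>j<n. as ! j \<in> grade S (es ! j)) \<longrightarrow>
      f (pure_tensor K S as) = g as es)"
  note pure = pure_tensor_closed[OF module_axioms homogeneous_word_in_tensor_words]
  from homogeneous_extension_exists[of N n g, OF N g]
  obtain f where f: "f \<in> linear_maps K ?T N"
    and val: "\<And>as es. homogeneous_word n as es \<Longrightarrow> f (pure_tensor K S as) = g as es"
    by blast
  have ex: "?P (restrict f (carrier ?T))"
  proof (intro conjI allI impI)
    show "restrict f (carrier ?T) \<in> linear_maps K ?T N"
      by (rule linear_maps_cong[OF f]) (simp_all add: module_tensor_power module_axioms)
  qed (use val pure in \<open>auto simp: homogeneous_word_def\<close>)
  have unique: "f1 = restrict f (carrier ?T)" if f1: "?P f1" for f1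
  proof (rule extensionalityI[of _ "carrier ?T"])
    fix t assume t: "t \<in> carrier ?T"
    have "f1 t = f t"
    proof (rule linear_maps_eqI_homogeneous[OF N _ f _ t])
      show "f1 \<in> linear_maps K ?T N" using f1 by blast
      show "f1 (pure_tensor K S as) = f (pure_tensor K S as)" if "homogeneous_word n as es" for as es
        using f1 val[OF that] that by (auto simp: homogeneous_word_def)
    qed
    then show "f1 t = restrict f (carrier ?T) t" using t by simp
  qed (use f1 in auto)
  have "?P (THE f. ?P f)"
    using ex unique by (rule theI[where P = ?P])
  then show "homogeneous_extension K S n N g \<in> linear_maps K ?T N"
    and "homogeneous_word n as es \<Longrightarrow> homogeneous_extension K S n N g (pure_tensor K S as) = g as es"
    unfolding homogeneous_extension_def by (auto simp: homogeneous_word_def)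
qed

end

section \<open>Graded algebras and supermatrices\<close>

text \<open>The common setting for a superalgebra and its supermatrices: what the face maps require of
  either is a bilinear product under which parities add.\<close>

locale graded_algebra = graded_module K S
  for K :: "('k, 'z) ring_scheme" (structure)
    and S :: "('k, 'a, 'y) superalgebra_scheme" (structure) +
  assumes mult_right_linear: "x \<in> carrier S \<Longrightarrow> (\<lambda>y. x \<otimes>\<^bsub>S\<^esub> y) \<in> linear_maps K S S"
    and mult_left_linear: "y \<in> carrier S \<Longrightarrow> (\<lambda>x. x \<otimes>\<^bsub>S\<^esub> y) \<in> linear_maps K S S"
    and grade_mult: "x \<in> grade S e \<Longrightarrow> y \<in> grade S e' \<Longrightarrow> x \<otimes>\<^bsub>S\<^esub> y \<in> grade S (e + e')"
begin

lemma mult_closed: "x \<in> carrier S \<Longrightarrow> y \<in> carrier S \<Longrightarrow> x \<otimes>\<^bsub>S\<^esub> y \<in> carrier S"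
  using linear_mapsD(1)[OF mult_right_linear] .

end

lemma superalgebra_imp_graded_algebra:
  assumes "superalgebra K S"
  shows "graded_algebra K S"
proof -
  interpret superalgebra K S by fact
  show ?thesis
    by (intro graded_algebra.intro graded_module.intro graded_module_axioms.intro
          graded_algebra_axioms.intro module_axioms)
      (auto intro!: linear_mapsI grade_submodule grade_sum grade_mult
        simp: grade_inter smult_mult_left smult_mult_right l_distr r_distr)
qed

definition block_parity :: "nat \<Rightarrow> nat \<Rightarrow> bit" where
  "block_parity p i = (if i < p then 0 else 1)"

context
  fixes R :: "('k, 'a, 'y) superalgebra_scheme" and p q :: nat
begin

lemma supermatrices_simps:
  "A \<in> carrier (supermatrices R p q) \<longleftrightarrow>
    A \<in> carrier_mat (p + q) (p + q) \<and> (\<forall>i<p + q. \<forall>j<p + q. A $$ (i, j) \<in> carrier R)"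
  "A \<oplus>\<^bsub>supermatrices R p q\<^esub> B = mat (p + q) (p + q) (\<lambda>ij. A $$ ij \<oplus>\<^bsub>R\<^esub> B $$ ij)"
  "\<zero>\<^bsub>supermatrices R p q\<^esub> = mat (p + q) (p + q) (\<lambda>_. \<zero>\<^bsub>R\<^esub>)"
  "c \<odot>\<^bsub>supermatrices R p q\<^esub> A = mat (p + q) (p + q) (\<lambda>ij. c \<odot>\<^bsub>R\<^esub> A $$ ij)"
  "A \<otimes>\<^bsub>supermatrices R p q\<^esub> B =
    mat (p + q) (p + q) (\<lambda>(i, j). \<Oplus>\<^bsub>R\<^esub>l\<in>{..<p + q}. A $$ (i, l) \<otimes>\<^bsub>R\<^esub> B $$ (l, j))"
  by (simp_all add: supermatrices_def Let_def)

lemma supermatrices_eqI: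
  assumes "A \<in> carrier (supermatrices R p q)" "B \<in> carrier (supermatrices R p q)"
    and "\<And>i j. i < p + q \<Longrightarrow> j < p + q \<Longrightarrow> A $$ (i, j) = B $$ (i, j)"
  shows "A = B"
  using assms by (intro eq_matI) (auto simp: supermatrices_simps)

text \<open>With block parities the four cases of the grading become one formula, in which the
  contributions of an inner index \<open>l\<close> of a matrix product occur twice and cancel.\<close>

lemma grade_supermatrices:
  assumes "module K R" "\<And>e. submodule (grade R e) K R"
  shows "A \<in> grade (supermatrices R p q) e \<longleftrightarrow>
    A \<in> carrier_mat (p + q) (p + q) \<and>
    (\<forall>i<p + q. \<forall>j<p + q. A $$ (i, j) \<in> grade R (e + block_parity p i + block_parity p j))"
proof -
  interpret R: module K R by (rule assms(1))
  have "(if (i < p) = (j < p) then e else e + 1) = e + block_parity p i + block_parity p j" for i j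
    by (cases e) (auto simp: block_parity_def)
  moreover have closed: "x \<in> carrier R" if "x \<in> grade R e" for x e
    using that R.submoduleE(1)[OF assms(2)] by blast
  ultimately show ?thesis
    by (auto simp: supermatrices_def Let_def) (blast intro: closed)
qed

context
  fixes K :: "('k, 'z) ring_scheme"
  assumes R: "graded_algebra K R"
begin

interpretation R: graded_algebra K R by (fact R)

lemma module_supermatrices: "module K (supermatrices R p q)" (is "module K ?M")
proof (rule moduleI[OF R.R.cring_axioms abelian_groupI])
  fix A assume A: "A \<in> carrier ?M"
  show "\<exists>B\<in>carrier ?M. B \<oplus>\<^bsub>?M\<^esub> A = \<zero>\<^bsub>?M\<^esub>"
    using A by (intro bexI[of _ "mat (p + q) (p + q) (\<lambda>ij. \<ominus>\<^bsub>R\<^esub> A $$ ij)"])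
      (auto simp: supermatrices_simps R.M.l_neg)
qed (auto simp: supermatrices_simps R.M.a_ac R.smult_l_distr R.smult_r_distr R.smult_assoc1)

lemma mat_entry_linear: "i < p + q \<Longrightarrow> j < p + q \<Longrightarrow> (\<lambda>A. A $$ (i, j)) \<in> linear_maps K (supermatrices R p q) R"
  by (rule linear_mapsI) (simp_all add: supermatrices_simps)

lemma mult_entry:
  "i < p + q \<Longrightarrow> j < p + q \<Longrightarrow>
    (A \<otimes>\<^bsub>supermatrices R p q\<^esub> B) $$ (i, j) = (\<Oplus>\<^bsub>R\<^esub>l\<in>{..<p + q}. A $$ (i, l) \<otimes>\<^bsub>R\<^esub> B $$ (l, j))"
  by (simp add: supermatrices_simps)

lemma finsum_in_submodule:
  assumes "submodule H K R" "\<And>i. i \<in> I \<Longrightarrow> f i \<in> H"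
  shows "(\<Oplus>\<^bsub>R\<^esub>i\<in>I. f i) \<in> H"
proof -
  have sub: "H \<subseteq> carrier R" and zero: "\<zero>\<^bsub>R\<^esub> \<in> H"
    using R.submoduleE(1)[OF assms(1)] subgroup.one_closed[OF submodule.axioms(1)[OF assms(1)]] by auto
  show ?thesis
    using assms(2)
  proof (induction I rule: infinite_finite_induct)
    case (insert i I)
    then show ?case
      using sub by (subst R.M.finsum_insert) (auto intro!: R.submoduleE(5)[OF assms(1)])
  qed (simp_all add: zero R.M.finsum_infinite)
qed

text \<open>All axioms are checked entry by entry. The homogeneous part of parity \<open>e\<close> of a matrix has as
  its \<open>(i, j)\<close> entry the part of parity \<open>e + |i| + |j|\<close> of the entry of the matrix.\<close>

lemma graded_algebra_supermatrices: "graded_algebra K (supermatrices R p q)" (is "graded_algebra K ?M")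
proof -
  interpret M: module K ?M by (rule module_supermatrices)
  note gr = grade_supermatrices[OF R.module_axioms R.grade_submodule]
  have mult_mem: "A \<otimes>\<^bsub>?M\<^esub> B \<in> carrier ?M" if "A \<in> carrier ?M" "B \<in> carrier ?M" for A B
    using that by (auto simp: supermatrices_simps intro!: R.M.finsum_closed R.mult_closed)
  have gr_closed: "A \<in> carrier ?M" if "A \<in> grade ?M e" for A e
    using that R.grade_closed by (auto simp: gr supermatrices_simps)
  show ?thesis
  proof (intro graded_algebra.intro graded_module.intro graded_module_axioms.intro
      graded_algebra_axioms.intro module_supermatrices)
    fix e
    show "submodule (grade ?M e) K ?M"
    proof (rule M.submoduleI)
      fix A assume A: "A \<in> grade ?M e"
      have "\<ominus>\<^bsub>?M\<^esub> A = (\<ominus>\<^bsub>K\<^esub> \<one>\<^bsub>K\<^esub>) \<odot>\<^bsub>?M\<^esub> A"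
        using gr_closed[OF A] by (simp add: M.smult_l_minus)
      then show "\<ominus>\<^bsub>?M\<^esub> A \<in> grade ?M e"
        using A by (auto simp: gr supermatrices_simps intro: R.grade_smult)
    qed (use gr_closed R.grade_zero R.grade_add R.grade_smult in \<open>auto simp: gr supermatrices_simps\<close>)
  next
    fix A assume A: "A \<in> carrier ?M"
    define P where "P e = mat (p + q) (p + q)
      (\<lambda>(i, j). R.component (e + block_parity p i + block_parity p j) (A $$ (i, j)))" for e
    have P: "P e \<in> grade ?M e" for e
      using A by (auto simp: gr P_def supermatrices_simps R.component_grade)
    have "A = P 0 \<oplus>\<^bsub>?M\<^esub> P 1"
    proof (rule supermatrices_eqI[OF A])
      show "P 0 \<oplus>\<^bsub>?M\<^esub> P 1 \<in> carrier ?M" using P gr_closed by blast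
      fix i j assume ij: "i < p + q" "j < p + q"
      then show "A $$ (i, j) = (P 0 \<oplus>\<^bsub>?M\<^esub> P 1) $$ (i, j)"
        using A R.component_sum[of "A $$ (i, j)" "block_parity p i + block_parity p j"]
        by (simp add: P_def supermatrices_simps add.commute add.left_commute)
    qed
    then show "\<exists>A0\<in>grade ?M 0. \<exists>A1\<in>grade ?M 1. A = A0 \<oplus>\<^bsub>?M\<^esub> A1" using P by blast
  next
    have "A = \<zero>\<^bsub>?M\<^esub>" if A: "A \<in> grade ?M 0" "A \<in> grade ?M 1" for A
    proof (rule supermatrices_eqI[OF gr_closed[OF A(1)] M.M.zero_closed])
      fix i j assume ij: "i < p + q" "j < p + q"
      then have "A $$ (i, j) \<in> grade R (0 + (block_parity p i + block_parity p j))"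
        "A $$ (i, j) \<in> grade R (1 + (block_parity p i + block_parity p j))"
        using A by (auto simp: gr add.assoc)
      then have "A $$ (i, j) \<in> grade R 0 \<inter> grade R 1"
        by (cases "block_parity p i + block_parity p j") auto
      then show "A $$ (i, j) = \<zero>\<^bsub>?M\<^esub> $$ (i, j)"
        using R.grade_inter ij by (simp add: supermatrices_simps)
    qed
    moreover have "\<zero>\<^bsub>?M\<^esub> \<in> grade ?M e" for e
      using R.grade_zero by (auto simp: gr supermatrices_simps)
    ultimately show "grade ?M 0 \<inter> grade ?M 1 = {\<zero>\<^bsub>?M\<^esub>}" by blast
  next
    fix A assume A: "A \<in> carrier ?M"
    have entry: "(\<lambda>B. (A \<otimes>\<^bsub>?M\<^esub> B) $$ (i, j)) \<in> linear_maps K ?M R"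
      "(\<lambda>B. (B \<otimes>\<^bsub>?M\<^esub> A) $$ (i, j)) \<in> linear_maps K ?M R"
      if ij: "i < p + q" "j < p + q" for i j
    proof -
      have "(\<lambda>B. A $$ (i, l) \<otimes>\<^bsub>R\<^esub> B $$ (l, j)) \<in> linear_maps K ?M R"
        "(\<lambda>B. B $$ (i, l) \<otimes>\<^bsub>R\<^esub> A $$ (l, j)) \<in> linear_maps K ?M R" if "l < p + q" for l
        using that ij A
        by (auto simp: supermatrices_simps intro!: linear_maps_comp[OF R.mult_right_linear]
          linear_maps_comp[OF R.mult_left_linear] mat_entry_linear)
      then show "(\<lambda>B. (A \<otimes>\<^bsub>?M\<^esub> B) $$ (i, j)) \<in> linear_maps K ?M R"
        "(\<lambda>B. (B \<otimes>\<^bsub>?M\<^esub> A) $$ (i, j)) \<in> linear_maps K ?M R"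
        unfolding mult_entry[OF ij]
        by (auto intro!: linear_maps_finsum_pointwise M.module_axioms R.module_axioms)
    qed
    show "(\<lambda>B. A \<otimes>\<^bsub>?M\<^esub> B) \<in> linear_maps K ?M ?M"
      using linear_mapsD[OF entry(1)] mult_mem[OF A]
      by (intro linear_mapsI supermatrices_eqI) (simp_all add: linear_mapsD[OF mat_entry_linear])
    show "(\<lambda>B. B \<otimes>\<^bsub>?M\<^esub> A) \<in> linear_maps K ?M ?M"
      using linear_mapsD[OF entry(2)] mult_mem[OF _ A]
      by (intro linear_mapsI supermatrices_eqI) (simp_all add: linear_mapsD[OF mat_entry_linear])
  next
    fix A B e e' assume A: "A \<in> grade ?M e" and B: "B \<in> grade ?M e'"
    have cancel: "e + block_parity p i + block_parity p l + (e' + block_parity p l + block_parity p j) =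
        e + e' + block_parity p i + block_parity p j" for i j l
      by (cases "block_parity p l") (simp_all add: ac_simps)
    show "A \<otimes>\<^bsub>?M\<^esub> B \<in> grade ?M (e + e')"
      unfolding gr
    proof (intro conjI allI impI)
      fix i j assume ij: "i < p + q" "j < p + q"
      have "A $$ (i, l) \<otimes>\<^bsub>R\<^esub> B $$ (l, j) \<in> grade R (e + e' + block_parity p i + block_parity p j)"
        if "l < p + q" for l
        unfolding cancel[of i l j, symmetric]
        using A B ij that by (intro R.grade_mult) (auto simp: gr)
      then show "(A \<otimes>\<^bsub>?M\<^esub> B) $$ (i, j) \<in> grade R (e + e' + block_parity p i + block_parity p j)"
        unfolding mult_entry[OF ij] by (intro finsum_in_submodule R.grade_submodule) auto
    qed (simp add: supermatrices_simps)
  qed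
qed

end

end

section \<open>Faces as contractions of a cyclic word\<close>

text \<open>A word \<open>a\<^sub>0 \<dots> a\<^sub>m\<close> is read as written on a circle, and each face, the last one included,
  multiplies a letter \<open>a\<^sub>i\<close> by its cyclic successor. Position \<open>j\<close> of the shorter word comes
  from position \<open>slot m i j\<close> of the longer one, where the product of \<open>a\<^sub>i\<close> and its successor is
  regarded as coming from \<open>i\<close>. For \<open>i = m\<close> the product stands in position \<open>0\<close>. The function
  \<open>unslot m i\<close> is the inverse; only the position of the successor of \<open>i\<close> is not a slot.\<close>

definition slot :: "nat \<Rightarrow> nat \<Rightarrow> nat \<Rightarrow> nat" where
  "slot m i j = (if i < m then if j \<le> i then j else j + 1 else if j = 0 then m else j)"

definition unslot :: "nat \<Rightarrow> nat \<Rightarrow> nat \<Rightarrow> nat" where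
  "unslot m i r = (if i < m then if r \<le> i then r else r - 1 else if r = m then 0 else r)"

definition cyc_suc :: "nat \<Rightarrow> nat \<Rightarrow> nat" where
  "cyc_suc m j = (j + 1) mod (m + 1)"

lemma cyc_suc_eq: "j \<le> m \<Longrightarrow> cyc_suc m j = (if j < m then j + 1 else 0)"
  by (auto simp: cyc_suc_def)

context
  fixes m i :: nat
  assumes m: "m \<ge> 1" and i: "i \<le> m"
begin

lemma cyc_suc_le: "cyc_suc m i \<le> m" and cyc_suc_neq: "cyc_suc m i \<noteq> i"
  using m i by (auto simp: cyc_suc_eq)

lemma slot_le: "j < m \<Longrightarrow> slot m i j \<le> m"
  and slot_neq: "j < m \<Longrightarrow> slot m i j \<noteq> cyc_suc m i"
  and unslot_slot: "j < m \<Longrightarrow> unslot m i (slot m i j) = j"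
  using m i by (auto simp: slot_def unslot_def cyc_suc_eq)

lemma unslot_less: "r \<le> m \<Longrightarrow> r \<noteq> cyc_suc m i \<Longrightarrow> unslot m i r < m"
  and slot_unslot: "r \<le> m \<Longrightarrow> r \<noteq> cyc_suc m i \<Longrightarrow> slot m i (unslot m i r) = r"
  using m i by (auto simp: slot_def unslot_def cyc_suc_eq)

lemma bij_betw_slot: "bij_betw (slot m i) {..<m} ({..m} - {cyc_suc m i})"
  by (rule bij_betwI[where g = "unslot m i"])
    (auto simp: slot_le slot_neq unslot_slot unslot_less slot_unslot)

text \<open>This says that the shorter circle arises from the longer one by removing the point after \<open>i\<close>:
  going one step from \<open>i\<close> skips this point, and every other step is unchanged. It is what makes
  one computation serve for all the faces.\<close>

lemma slot_cyc_suc: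
  assumes "j < m"
  shows "slot m i (cyc_suc (m - 1) j) =
    (if slot m i j = i then cyc_suc m (cyc_suc m i) else cyc_suc m (slot m i j))"
  using m i assms by (auto simp: slot_def cyc_suc_eq)

lemma slot_zero_last: "slot m m 0 = m"
  by (simp add: slot_def)

end

definition contract :: "('a, 'y) monoid_scheme \<Rightarrow> nat \<Rightarrow> nat \<Rightarrow> 'a list \<Rightarrow> 'a list" where
  "contract S m i as =
    map (\<lambda>j. if slot m i j = i then as ! i \<otimes>\<^bsub>S\<^esub> as ! cyc_suc m i else as ! slot m i j) [0..<m]"

definition contract_parities :: "nat \<Rightarrow> nat \<Rightarrow> bit list \<Rightarrow> bit list" where
  "contract_parities m i es =
    map (\<lambda>j. if slot m i j = i then es ! i + es ! cyc_suc m i else es ! slot m i j) [0..<m]"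

text \<open>The exponent of the Koszul sign of a face: the last letter of the last face passes all others.\<close>

definition face_parity :: "nat \<Rightarrow> nat \<Rightarrow> bit list \<Rightarrow> bit" where
  "face_parity m i es = (if i < m then 0 else es ! m * (\<Sum>j<m. es ! j))"

lemma contract_inner:
  assumes "i < m" "length as = m + 1"
  shows "contract S m i as = take i as @ [as ! i \<otimes>\<^bsub>S\<^esub> as ! (i + 1)] @ drop (i + 2) as"
proof (rule nth_equalityI)
  fix j assume "j < length (contract S m i as)"
  then have j: "j < m" by (simp add: contract_def)
  show "contract S m i as ! j = (take i as @ [as ! i \<otimes>\<^bsub>S\<^esub> as ! (i + 1)] @ drop (i + 2) as) ! j"
  proof (cases "j \<le> i")
    case True
    then show ?thesis
      using assms j by (auto simp: contract_def slot_def cyc_suc_eq nth_append)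
  next
    case False
    then obtain d where "j = Suc (i + d)" by (metis less_imp_Suc_add not_le)
    then show ?thesis
      using assms j by (auto simp: contract_def slot_def cyc_suc_eq nth_append)
  qed
qed (use assms in \<open>auto simp: contract_def\<close>)

lemma contract_last:
  assumes "m \<ge> 1" "length as = m + 1"
  shows "contract S m m as = (as ! m \<otimes>\<^bsub>S\<^esub> as ! 0) # map (\<lambda>j. as ! j) [1..<m]"
  using assms by (intro nth_equalityI)
    (auto simp: contract_def slot_def cyc_suc_eq nth_Cons split: nat.splits)

lemma sum_contract_parities:
  assumes m: "m \<ge> 1" "i \<le> m" and "length es = m + 1"
  shows "(\<Sum>j\<le>m - 1. contract_parities m i es ! j) = (\<Sum>j\<le>m. es ! j)"
proof -
  let ?c = "cyc_suc m i"
  have le: "{..m - 1} = {..<m}" using m by auto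
  have i: "i \<in> {..m} - {?c}" using m cyc_suc_neq[OF m] by auto
  have "(\<Sum>j\<le>m - 1. contract_parities m i es ! j) =
      (\<Sum>j<m. es ! slot m i j + (if slot m i j = i then es ! ?c else 0))"
    unfolding le by (intro sum.cong) (auto simp: contract_parities_def)
  also have "\<dots> = (\<Sum>r\<in>{..m} - {?c}. es ! r + (if r = i then es ! ?c else 0))"
    by (rule sum.reindex_bij_betw[OF bij_betw_slot[OF m]])
  also have "\<dots> = (\<Sum>r\<in>{..m} - {?c}. es ! r) + es ! ?c"
    using i by (simp add: sum.distrib)
  also have "\<dots> = (\<Sum>j\<le>m. es ! j)"
    using cyc_suc_le[OF m] by (subst sum.remove[of _ ?c]) (auto simp: add.commute)
  finally show ?thesis .
qed

lemma parity_sign_closed [simp]: "cring K \<Longrightarrow> parity_sign K e \<in> carrier K"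
proof -
  assume "cring K"
  then interpret cring K .
  show ?thesis by (simp add: parity_sign_def)
qed

lemma parity_sign_add:
  assumes "cring K"
  shows "parity_sign K (e + e') = parity_sign K e \<otimes>\<^bsub>K\<^esub> parity_sign K e'"
proof -
  interpret cring K by fact
  show ?thesis by (cases e; cases e') (auto simp: parity_sign_def l_minus r_minus)
qed

context graded_algebra
begin

lemma contract_word:
  assumes m: "m \<ge> 1" "i \<le> m" and as: "as \<in> tensor_words S (m + 1)"
  shows "contract S m i as \<in> tensor_words S m"
proof -
  have "as ! slot m i j \<in> carrier S" if "j < m" for j
    using as slot_le[OF m that] by (auto simp: tensor_words_iff_nth)
  moreover have "as ! i \<otimes>\<^bsub>S\<^esub> as ! cyc_suc m i \<in> carrier S"
    using as m cyc_suc_le[OF m] by (intro mult_closed) (auto simp: tensor_words_iff_nth)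
  ultimately show ?thesis by (simp add: tensor_words_iff_nth contract_def)
qed

lemma multilinear_contract:
  assumes m: "m \<ge> 1" "i \<le> m" and \<phi>: "multilinear K S m N \<phi>"
  shows "multilinear K S (m + 1) N (\<lambda>as. \<phi> (contract S m i as))"
proof (rule multilinear_slotwise_linear[OF \<phi> contract_word[OF m] _ module_axioms])
  fix as r assume as: "as \<in> tensor_words S (m + 1)" and r: "r < m + 1"
  have len: "length as = m + 1" using as by (simp add: tensor_words_def)
  note ci = cyc_suc_le[OF m] cyc_suc_neq[OF m]
  have slot_eq: "slot m i j = r' \<longleftrightarrow> j = unslot m i r'" "r' = slot m i j \<longleftrightarrow> j = unslot m i r'"
    if "j < m" "r' \<le> m" "r' \<noteq> cyc_suc m i" for j r'
    using that unslot_slot[OF m, of j] slot_unslot[OF m, of r'] by auto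
  have car: "as ! i \<in> carrier S" "as ! cyc_suc m i \<in> carrier S"
    using as m ci by (auto simp: tensor_words_iff_nth)
  consider "r = i" | "r = cyc_suc m i" | "r \<noteq> i" "r \<noteq> cyc_suc m i" by blast
  then show "\<exists>j<m. \<exists>L\<in>linear_maps K S S. \<forall>x\<in>carrier S. contract S m i (as[r := x]) = (contract S m i as)[j := L x]"
  proof cases
    case 1
    have "contract S m i (as[r := x]) = (contract S m i as)[unslot m i i := x \<otimes>\<^bsub>S\<^esub> as ! cyc_suc m i]" for x
      using 1 r len m ci slot_eq
      by (intro nth_equalityI) (auto simp: contract_def nth_list_update)
    then show ?thesis
      using mult_left_linear[OF car(2)] unslot_less[OF m] m ci by (auto intro!: exI bexI)
  next
    case 2
    have "contract S m i (as[r := x]) = (contract S m i as)[unslot m i i := as ! i \<otimes>\<^bsub>S\<^esub> x]" for x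
      using 2 r len m ci slot_eq slot_neq[OF m] not_sym[OF slot_neq[OF m]]
      by (intro nth_equalityI) (auto simp: contract_def nth_list_update)
    then show ?thesis
      using mult_right_linear[OF car(1)] unslot_less[OF m] m ci by (auto intro!: exI bexI)
  next
    case 3
    have ne: "unslot m i r \<noteq> unslot m i i"
      using 3 r m ci slot_unslot[OF m, of r] slot_unslot[OF m, of i] by auto
    have "contract S m i (as[r := x]) = (contract S m i as)[unslot m i r := x]" for x
      using 3 r len m ci slot_eq ne
      by (intro nth_equalityI) (auto simp: contract_def nth_list_update)
    moreover have "(\<lambda>x. x) \<in> linear_maps K S S" by (rule linear_mapsI) auto
    ultimately show ?thesis
      using unslot_less[OF m] 3 r by (intro exI[of _ "unslot m i r"] conjI bexI) auto
  qed
qed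

lemma homogeneous_contract:
  assumes m: "m \<ge> 1" "i \<le> m" and h: "homogeneous_word (m + 1) as es"
  shows "homogeneous_word m (contract S m i as) (contract_parities m i es)"
  using h m cyc_suc_le[OF m] slot_le[OF m]
  by (auto simp: homogeneous_word_def contract_def contract_parities_def less_Suc_eq_le intro!: grade_mult)

text \<open>The defining formula of a face distinguishes the last face from the others, and
  \<open>contract_inner\<close> and \<open>contract_last\<close> turn both cases into a signed contraction.\<close>

lemma hochschild_face:
  assumes m: "m \<ge> 1" "i \<le> m"
  shows "hochschild_face K S m i \<in> linear_maps K (tensor_power K S (m + 1)) (tensor_power K S m)"
    and "homogeneous_word (m + 1) as es \<Longrightarrow> hochschild_face K S m i (pure_tensor K S as) =
      parity_sign K (face_parity m i es) \<odot>\<^bsub>tensor_power K S m\<^esub> pure_tensor K S (contract S m i as)"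
proof -
  let ?g = "\<lambda>as es. if i < m then pure_tensor K S (take i as @ [as ! i \<otimes>\<^bsub>S\<^esub> as ! (i + 1)] @ drop (i + 2) as)
        else parity_sign K (es ! m * (\<Sum>j<m. es ! j)) \<odot>\<^bsub>hochschild_chains K S (m - 1)\<^esub>
          pure_tensor K S ((as ! m \<otimes>\<^bsub>S\<^esub> as ! 0) # map (\<lambda>j. as ! j) [1..<m])"
  have T: "hochschild_chains K S (m - 1) = tensor_power K S m"
    using m by (simp add: hochschild_chains_def)
  interpret T: module K "tensor_power K S m" by (rule module_tensor_power[OF module_axioms])
  note ml = multilinear_contract[OF m multilinear_pure_tensor[OF module_axioms]]
  have g_eq: "parity_sign K (face_parity m i es) \<odot>\<^bsub>tensor_power K S m\<^esub> pure_tensor K S (contract S m i as) = ?g as es"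
    if as: "as \<in> tensor_words S (m + 1)" for as es
  proof (cases "i < m")
    case True
    have "pure_tensor K S (contract S m i as) \<in> carrier (tensor_power K S m)"
      by (rule multilinearD(1)[OF ml as])
    with True show ?thesis
      using as contract_inner[OF True, of as S]
      by (simp add: face_parity_def parity_sign_def tensor_words_def)
  next
    case False
    then have "i = m" using m by simp
    then show ?thesis
      using as m unfolding T by (simp add: face_parity_def tensor_words_def contract_last)
  qed
  have g: "multilinear K S (m + 1) (tensor_power K S m) (\<lambda>as. ?g as es)" for es
    by (rule multilinear_cong[OF multilinear_smult[OF module_axioms T.module_axioms _ ml] g_eq module_axioms])
      (simp_all add: R.cring_axioms)
  note ext = homogeneous_extension[OF T.module_axioms, of "m + 1" ?g, OF g]
  show "hochschild_face K S m i \<in> linear_maps K (tensor_power K S (m + 1)) (tensor_power K S m)"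
    using ext(1) unfolding hochschild_face_def T .
  show "hochschild_face K S m i (pure_tensor K S as) =
      parity_sign K (face_parity m i es) \<odot>\<^bsub>tensor_power K S m\<^esub> pure_tensor K S (contract S m i as)"
    if h: "homogeneous_word (m + 1) as es"
    using ext(2)[OF h] g_eq[OF homogeneous_word_in_tensor_words[OF h], of es]
    unfolding hochschild_face_def T by simp
qed

end

section \<open>The Dennis supertrace is a chain map\<close>

lemma (in abelian_monoid) finsum_cartesian_product:
  assumes "finite A" "finite B" "\<And>a b. a \<in> A \<Longrightarrow> b \<in> B \<Longrightarrow> f (a, b) \<in> carrier G"
  shows "(\<Oplus>x\<in>A \<times> B. f x) = (\<Oplus>a\<in>A. \<Oplus>b\<in>B. f (a, b))"
  using assms(1,3)
proof (induction A rule: finite_induct)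
  case (insert a A)
  have row: "(\<Oplus>x\<in>Pair a ` B. f x) = (\<Oplus>b\<in>B. f (a, b))"
    using insert.prems by (intro finsum_reindex) (auto simp: inj_on_def)
  have "insert a A \<times> B = Pair a ` B \<union> A \<times> B" by auto
  then have "(\<Oplus>x\<in>insert a A \<times> B. f x) = (\<Oplus>x\<in>Pair a ` B. f x) \<oplus> (\<Oplus>x\<in>A \<times> B. f x)"
    using insert assms(2) by (simp only:) (rule finsum_Un_disjoint; auto)
  then show ?case
    using insert row by (simp add: Pi_def finsum_closed)
qed simp

definition index_lists :: "nat \<Rightarrow> nat \<Rightarrow> nat list set" where
  "index_lists n m = {ix. length ix = m + 1 \<and> set ix \<subseteq> {..<n}}"

lemma finite_index_lists: "finite (index_lists n m)"
  using finite_lists_length_eq[of "{..<n}" "m + 1"] by (simp add: index_lists_def conj_commute)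

lemma index_lists_iff: "ix \<in> index_lists n m \<longleftrightarrow> length ix = m + 1 \<and> (\<forall>j\<le>m. ix ! j < n)"
proof -
  have "set ix \<subseteq> {..<n} \<longleftrightarrow> (\<forall>j<length ix. ix ! j < n)"
    unfolding all_set_conv_all_nth[of ix "\<lambda>x. x < n", symmetric] by auto
  then show ?thesis by (auto simp: index_lists_def less_Suc_eq_le)
qed

lemma index_lists_nth: "ix \<in> index_lists n m \<Longrightarrow> j \<le> m \<Longrightarrow> ix ! j < n"
  by (simp add: index_lists_iff)

text \<open>Matrix multiplication has an inner summation index. The index list of the longer word
  arises from that of the shorter word by inserting this index \<open>l\<close> at the position between the two
  merged matrices, which on the circle is the position after \<open>i\<close>.\<close>

definition insert_index :: "nat \<Rightarrow> nat \<Rightarrow> nat list \<Rightarrow> nat \<Rightarrow> nat list" where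
  "insert_index m i jx l =
    map (\<lambda>r. if r = cyc_suc m i then l else jx ! unslot m i r) [0..<m + 1]"

lemma insert_index_nth:
  assumes m: "m \<ge> 1" "i \<le> m"
  shows "j < m \<Longrightarrow> insert_index m i jx l ! slot m i j = jx ! j"
    and "insert_index m i jx l ! cyc_suc m i = l"
  using slot_le[OF m] slot_neq[OF m] unslot_slot[OF m] cyc_suc_le[OF m]
  by (auto simp: insert_index_def less_Suc_eq_le simp del: upt_Suc)

text \<open>Hence summing over the index lists of the longer word is the same as summing over those of
  the shorter word and over the inner index of the merged product.\<close>

lemma bij_betw_insert_index:
  assumes m: "m \<ge> 1" "i \<le> m"
  shows "bij_betw (\<lambda>(jx, l). insert_index m i jx l) (index_lists n (m - 1) \<times> {..<n}) (index_lists n m)"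
proof (rule bij_betwI[where g = "\<lambda>ix. (map (\<lambda>j. ix ! slot m i j) [0..<m], ix ! cyc_suc m i)"])
  show "(\<lambda>(jx, l). insert_index m i jx l) \<in> index_lists n (m - 1) \<times> {..<n} \<rightarrow> index_lists n m"
  proof safe
    fix jx l assume jx: "jx \<in> index_lists n (m - 1)" and l: "l < n"
    have "jx ! unslot m i r < n" if "r \<le> m" "r \<noteq> cyc_suc m i" for r
      using unslot_less[OF m that] by (intro index_lists_nth[OF jx]) auto
    with l show "insert_index m i jx l \<in> index_lists n m"
      by (auto simp: index_lists_iff insert_index_def nth_append)
  qed
  show "(\<lambda>ix. (map (\<lambda>j. ix ! slot m i j) [0..<m], ix ! cyc_suc m i)) \<in>
      index_lists n m \<rightarrow> index_lists n (m - 1) \<times> {..<n}"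
    using m slot_le[OF m] cyc_suc_le[OF m] by (auto simp: index_lists_iff)
next
  fix x assume "x \<in> index_lists n (m - 1) \<times> {..<n}"
  then obtain jx l where x: "x = (jx, l)" and len: "length jx = m"
    using m by (auto simp: index_lists_iff)
  have "map (\<lambda>j. insert_index m i jx l ! slot m i j) [0..<m] = jx"
    using len by (intro nth_equalityI) (auto simp: insert_index_nth[OF m])
  then show "(case case x of (jx, l) \<Rightarrow> insert_index m i jx l of
      ix \<Rightarrow> (map (\<lambda>j. ix ! slot m i j) [0..<m], ix ! cyc_suc m i)) = x"
    by (simp add: x insert_index_nth[OF m])
next
  fix ix assume ix: "ix \<in> index_lists n m"
  have "insert_index m i (map (\<lambda>j. ix ! slot m i j) [0..<m]) (ix ! cyc_suc m i) ! r = ix ! r"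
    if "r < m + 1" for r
    using that unslot_less[OF m, of r] slot_unslot[OF m, of r]
    by (auto simp: insert_index_def nth_append less_Suc_eq_le simp del: upt_Suc)
  then show "(case (map (\<lambda>j. ix ! slot m i j) [0..<m], ix ! cyc_suc m i) of
      (jx, l) \<Rightarrow> insert_index m i jx l) = ix"
    using ix by (auto intro!: nth_equalityI simp: index_lists_iff insert_index_def)
qed

definition cyclic_entries :: "nat \<Rightarrow> 'a mat list \<Rightarrow> nat list \<Rightarrow> 'a list" where
  "cyclic_entries m As ix = map (\<lambda>j. As ! j $$ (ix ! j, ix ! cyc_suc m j)) [0..<m + 1]"

definition cyclic_parities :: "nat \<Rightarrow> nat \<Rightarrow> bit list \<Rightarrow> nat list \<Rightarrow> bit list" where
  "cyclic_parities p m es ix =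
    map (\<lambda>j. es ! j + block_parity p (ix ! j) + block_parity p (ix ! cyc_suc m j)) [0..<m + 1]"

text \<open>The two blocks of the supertrace differ only in the sign exponent \<open>1 + |A\<^sub>0| + \<dots> + |A\<^sub>m|\<close> of
  the second one. Multiplying this exponent by the parity of \<open>i\<^sub>0\<close> merges the two sums into one.\<close>

definition supertrace_parity :: "nat \<Rightarrow> nat \<Rightarrow> bit list \<Rightarrow> nat list \<Rightarrow> bit" where
  "supertrace_parity p m es ix = (1 + (\<Sum>j\<le>m. es ! j)) * block_parity p (ix ! 0)"

text \<open>Modulo 2 the sign in the telescope does not matter.\<close>

lemma sum_bit_telescope:
  fixes f :: "nat \<Rightarrow> bit"
  shows "(\<Sum>j<m. f j + f (j + 1)) = f 0 + f m"
proof (induction m)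
  case 0
  then show ?case by (cases "f 0") auto
next
  case (Suc m)
  then show ?case by (cases "f m") (auto simp: ac_simps)
qed

text \<open>The cyclic face moves the entry in position \<open>m\<close> to the front, at the cost of the Koszul
  sign of the entries, and the supertrace then starts at the row index \<open>i\<^sub>m\<close> instead of \<open>i\<^sub>0\<close>.
  With \<open>a = |A\<^sub>m|\<close>, \<open>s = |A\<^sub>0| + \<dots> + |A\<^sub>m\<^sub>-\<^sub>1|\<close> and \<open>x = |i\<^sub>0| + |i\<^sub>m|\<close>, the Koszul sign of the entries
  has exponent \<open>(a + x) (s + x) = a s + x (1 + a + s)\<close>, so it is that of the matrices times
  exactly the change of sign between the blocks of \<open>i\<^sub>0\<close> and \<open>i\<^sub>m\<close>.\<close>

lemma face_sign_supertrace:
  assumes m: "m \<ge> 1" "i \<le> m" and len: "length es = m + 1"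
  shows "supertrace_parity p m es ix + face_parity m i (cyclic_parities p m es ix) =
    face_parity m i es + (1 + (\<Sum>j\<le>m. es ! j)) * block_parity p (ix ! slot m i 0)"
proof (cases "i < m")
  case True
  then show ?thesis by (simp add: supertrace_parity_def face_parity_def slot_def)
next
  case False
  then have i: "i = m" using m by simp
  let ?b = "\<lambda>j. block_parity p (ix ! j)"
  let ?s = "\<Sum>j<m. es ! j"
  have nth: "cyclic_parities p m es ix ! j = es ! j + ?b j + ?b (cyc_suc m j)" if "j \<le> m" for j
    using that by (simp add: cyclic_parities_def nth_append less_Suc_eq_le del: upt_Suc)
  have "(\<Sum>j<m. cyclic_parities p m es ix ! j) = (\<Sum>j<m. es ! j + (?b j + ?b (j + 1)))"
    by (intro sum.cong) (auto simp: nth cyc_suc_eq add.assoc)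
  also have "\<dots> = ?s + (\<Sum>j<m. ?b j + ?b (j + 1))"
    by (rule sum.distrib)
  also have "\<dots> = ?s + (?b 0 + ?b m)"
    by (simp only: sum_bit_telescope[of ?b])
  finally have sum: "(\<Sum>j<m. cyclic_parities p m es ix ! j) = ?s + (?b 0 + ?b m)" .
  have last: "cyclic_parities p m es ix ! m = es ! m + ?b m + ?b 0"
    by (simp add: nth cyc_suc_eq)
  have total: "(\<Sum>j\<le>m. es ! j) = ?s + es ! m"
    by (simp flip: lessThan_Suc_atMost)
  have bits: "(1 + (s + a)) * u + (a + v + u) * (s + (u + v)) = a * s + (1 + (s + a)) * v"
    for s a u v :: bit
    by (cases s; cases a; cases u; cases v) auto
  show ?thesis
    using bits[of ?s "es ! m" "?b 0" "?b m"]
    by (simp add: i supertrace_parity_def face_parity_def slot_zero_last[OF m] sum last total)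
qed

context
  fixes K :: "('k, 'z) ring_scheme" and R :: "('k, 'a, 'y) superalgebra_scheme" and p q :: nat
  assumes R: "graded_algebra K R"
begin

interpretation R: graded_algebra K R by (fact R)
interpretation M: graded_algebra K "supermatrices R p q"
  by (rule graded_algebra_supermatrices[OF R])

lemma cyclic_entry_tensor_eq: "cyclic_entry_tensor K R m As ix = pure_tensor K R (cyclic_entries m As ix)"
  by (simp add: cyclic_entry_tensor_def cyclic_entries_def cyc_suc_def)

lemma cyclic_entries_word:
  assumes "As \<in> tensor_words (supermatrices R p q) (m + 1)" "ix \<in> index_lists (p + q) m"
  shows "cyclic_entries m As ix \<in> tensor_words R (m + 1)"
proof -
  have "As ! j $$ (ix ! j, ix ! cyc_suc m j) \<in> carrier R" if "j \<le> m" for j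
  proof -
    have "cyc_suc m j \<le> m" using that by (simp add: cyc_suc_eq)
    moreover have "As ! j \<in> carrier (supermatrices R p q)"
      using assms(1) that by (simp add: tensor_words_iff_nth)
    ultimately show ?thesis
      using that index_lists_nth[OF assms(2)]
        linear_mapsD(1)[OF mat_entry_linear[OF R, where i = "ix ! j" and j = "ix ! cyc_suc m j" and p = p and q = q]]
      by simp
  qed
  then show ?thesis
    by (simp add: tensor_words_iff_nth cyclic_entries_def less_Suc_eq_le del: upt_Suc)
qed

lemma multilinear_cyclic_entries:
  assumes ix: "ix \<in> index_lists (p + q) m"
  shows "multilinear K (supermatrices R p q) (m + 1) (tensor_power K R (m + 1))
    (\<lambda>As. pure_tensor K R (cyclic_entries m As ix))"
proof (rule multilinear_slotwise_linear[OF multilinear_pure_tensor[OF R.module_axioms]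
      cyclic_entries_word[OF _ ix] _ M.module_axioms])
  fix As r assume As: "As \<in> tensor_words (supermatrices R p q) (m + 1)" and r: "r < m + 1"
  have "cyclic_entries m (As[r := A]) ix = (cyclic_entries m As ix)[r := A $$ (ix ! r, ix ! cyc_suc m r)]" for A
    using As r by (intro nth_equalityI)
      (auto simp: cyclic_entries_def tensor_words_def nth_list_update simp del: upt_Suc)
  moreover have "(\<lambda>A. A $$ (ix ! r, ix ! cyc_suc m r)) \<in> linear_maps K (supermatrices R p q) R"
    using r by (intro mat_entry_linear[OF R] index_lists_nth[OF ix]) (auto simp: cyc_suc_eq)
  ultimately show "\<exists>j<m + 1. \<exists>L\<in>linear_maps K (supermatrices R p q) R. \<forall>A\<in>carrier (supermatrices R p q).
      cyclic_entries m (As[r := A]) ix = (cyclic_entries m As ix)[j := L A]"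
    using r by (intro exI[of _ r] conjI bexI[of _ "\<lambda>A. A $$ (ix ! r, ix ! cyc_suc m r)"]) auto
qed

text \<open>Supertraces of homogeneous matrices are sums of homogeneous pure tensors, so the formula for a
  face can be applied to each summand. The parities of the entries vary with the index list.\<close>

lemma homogeneous_cyclic_entries:
  assumes h: "M.homogeneous_word (m + 1) As es" and ix: "ix \<in> index_lists (p + q) m"
  shows "R.homogeneous_word (m + 1) (cyclic_entries m As ix) (cyclic_parities p m es ix)"
proof -
  have "As ! j $$ (ix ! j, ix ! cyc_suc m j) \<in>
      grade R (es ! j + block_parity p (ix ! j) + block_parity p (ix ! cyc_suc m j))" if "j \<le> m" for j
  proof -
    have "cyc_suc m j \<le> m" using that by (simp add: cyc_suc_eq)
    moreover have "As ! j \<in> grade (supermatrices R p q) (es ! j)"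
      using h that by (simp add: M.homogeneous_word_def)
    ultimately show ?thesis
      using that index_lists_nth[OF ix]
      by (simp add: grade_supermatrices[OF R.module_axioms R.grade_submodule])
  qed
  then show ?thesis
    by (simp add: R.homogeneous_word_def cyclic_entries_def cyclic_parities_def less_Suc_eq_le del: upt_Suc)
qed

lemma dennis_supertrace:
  shows "dennis_supertrace K R p q m \<in>
      linear_maps K (tensor_power K (supermatrices R p q) (m + 1)) (tensor_power K R (m + 1))"
    and "M.homogeneous_word (m + 1) As es \<Longrightarrow>
      dennis_supertrace K R p q m (pure_tensor K (supermatrices R p q) As) =
      (\<Oplus>\<^bsub>tensor_power K R (m + 1)\<^esub>ix\<in>index_lists (p + q) m.
        parity_sign K (supertrace_parity p m es ix) \<odot>\<^bsub>tensor_power K R (m + 1)\<^esub>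
        pure_tensor K R (cyclic_entries m As ix))"
proof -
  let ?T = "tensor_power K R (m + 1)"
  let ?I0 = "{ix. length ix = m + 1 \<and> set ix \<subseteq> {..<p + q} \<and> ix ! 0 < p}"
  let ?I1 = "{ix. length ix = m + 1 \<and> set ix \<subseteq> {..<p + q} \<and> p \<le> ix ! 0}"
  let ?g = "\<lambda>As es. (\<Oplus>\<^bsub>?T\<^esub>ix\<in>?I0. cyclic_entry_tensor K R m As ix) \<oplus>\<^bsub>?T\<^esub>
    parity_sign K (1 + (\<Sum>j\<le>m. es ! j)) \<odot>\<^bsub>?T\<^esub> (\<Oplus>\<^bsub>?T\<^esub>ix\<in>?I1. cyclic_entry_tensor K R m As ix)"
  let ?h = "\<lambda>As es. \<Oplus>\<^bsub>?T\<^esub>ix\<in>index_lists (p + q) m.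
    parity_sign K (supertrace_parity p m es ix) \<odot>\<^bsub>?T\<^esub> pure_tensor K R (cyclic_entries m As ix)"
  interpret T: module K ?T by (rule module_tensor_power[OF R.module_axioms])
  note sign = parity_sign_closed[OF R.R.cring_axioms]
  have I: "index_lists (p + q) m = ?I0 \<union> ?I1" and disj: "?I0 \<inter> ?I1 = {}"
    by (auto simp: index_lists_def)
  have fin: "finite ?I0" "finite ?I1"
    using finite_index_lists[of "p + q" m] unfolding I by auto
  have eq: "?h As es = ?g As es" if As: "As \<in> tensor_words (supermatrices R p q) (m + 1)" for As es
  proof -
    let ?t = "cyclic_entry_tensor K R m As"
    let ?s = "\<lambda>ix. parity_sign K (supertrace_parity p m es ix)"
    have t: "?t ix \<in> carrier ?T" if "ix \<in> ?I0 \<union> ?I1" for ix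
      using multilinearD(1)[OF multilinear_cyclic_entries As, of ix] that
      unfolding I cyclic_entry_tensor_eq by blast
    have "?h As es = (\<Oplus>\<^bsub>?T\<^esub>ix\<in>?I0 \<union> ?I1. ?s ix \<odot>\<^bsub>?T\<^esub> ?t ix)"
      unfolding I cyclic_entry_tensor_eq ..
    also have "\<dots> = (\<Oplus>\<^bsub>?T\<^esub>ix\<in>?I0. ?s ix \<odot>\<^bsub>?T\<^esub> ?t ix) \<oplus>\<^bsub>?T\<^esub> (\<Oplus>\<^bsub>?T\<^esub>ix\<in>?I1. ?s ix \<odot>\<^bsub>?T\<^esub> ?t ix)"
      by (intro T.finsum_Un_disjoint fin disj Pi_I T.smult_closed sign t) auto
    also have "(\<Oplus>\<^bsub>?T\<^esub>ix\<in>?I0. ?s ix \<odot>\<^bsub>?T\<^esub> ?t ix) = (\<Oplus>\<^bsub>?T\<^esub>ix\<in>?I0. ?t ix)"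
    proof (rule T.finsum_cong'[OF refl])
      fix ix assume ix: "ix \<in> ?I0"
      then have "?s ix = \<one>\<^bsub>K\<^esub>"
        by (simp add: supertrace_parity_def block_parity_def parity_sign_def)
      then show "?s ix \<odot>\<^bsub>?T\<^esub> ?t ix = ?t ix"
        using ix by (simp only: T.smult_one[OF t[OF UnI1]])
    qed (intro Pi_I t UnI1)
    also have "(\<Oplus>\<^bsub>?T\<^esub>ix\<in>?I1. ?s ix \<odot>\<^bsub>?T\<^esub> ?t ix) =
        (\<Oplus>\<^bsub>?T\<^esub>ix\<in>?I1. parity_sign K (1 + (\<Sum>j\<le>m. es ! j)) \<odot>\<^bsub>?T\<^esub> ?t ix)"
    proof (rule T.finsum_cong'[OF refl])
      fix ix assume "ix \<in> ?I1"
      then show "?s ix \<odot>\<^bsub>?T\<^esub> ?t ix = parity_sign K (1 + (\<Sum>j\<le>m. es ! j)) \<odot>\<^bsub>?T\<^esub> ?t ix"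
        by (simp add: supertrace_parity_def block_parity_def)
    qed (intro Pi_I T.smult_closed sign t UnI2)
    also have "\<dots> = parity_sign K (1 + (\<Sum>j\<le>m. es ! j)) \<odot>\<^bsub>?T\<^esub> (\<Oplus>\<^bsub>?T\<^esub>ix\<in>?I1. ?t ix)"
      by (intro T.finsum_smult_ldistr[symmetric] fin sign Pi_I t UnI2)
    finally show ?thesis .
  qed
  have h: "multilinear K (supermatrices R p q) (m + 1) ?T (\<lambda>As. ?h As es)" for es
    by (intro multilinear_lincomb M.module_axioms T.module_axioms finite_index_lists
        multilinear_cyclic_entries sign)
  have g: "multilinear K (supermatrices R p q) (m + 1) ?T (\<lambda>As. ?g As es)" for es
    by (rule multilinear_cong[OF h eq M.module_axioms])
  note ext = M.homogeneous_extension[OF T.module_axioms, of "m + 1" ?g, OF g]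
  show "dennis_supertrace K R p q m \<in> linear_maps K (tensor_power K (supermatrices R p q) (m + 1)) ?T"
    using ext(1) unfolding dennis_supertrace_def hochschild_chains_def .
  show "dennis_supertrace K R p q m (pure_tensor K (supermatrices R p q) As) = ?h As es"
    if hom: "M.homogeneous_word (m + 1) As es"
    using ext(2)[OF hom] eq[OF M.homogeneous_word_in_tensor_words[OF hom], of es]
    unfolding dennis_supertrace_def hochschild_chains_def by simp
qed

text \<open>An entry of the product of the two merged matrices is a sum over the index \<open>l\<close> between them;
  by multilinearity the sum leaves the tensor.\<close>

lemma pure_tensor_contract_cyclic_entries:
  assumes m: "m \<ge> 1" "i \<le> m" and As: "As \<in> tensor_words (supermatrices R p q) (m + 1)"
    and jx: "jx \<in> index_lists (p + q) (m - 1)"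
  shows "pure_tensor K R (cyclic_entries (m - 1) (contract (supermatrices R p q) m i As) jx) =
    (\<Oplus>\<^bsub>tensor_power K R m\<^esub>l\<in>{..<p + q}.
      pure_tensor K R (contract R m i (cyclic_entries m As (insert_index m i jx l))))"
proof -
  let ?n = "p + q" and ?c = "cyc_suc m i" and ?k = "unslot m i i"
  let ?B = "cyclic_entries (m - 1) (contract (supermatrices R p q) m i As) jx"
  let ?ix = "insert_index m i jx"
  let ?x = "\<lambda>l. As ! i $$ (jx ! ?k, l) \<otimes>\<^bsub>R\<^esub> As ! ?c $$ (l, jx ! cyc_suc (m - 1) ?k)"
  note ci = cyc_suc_le[OF m] cyc_suc_neq[OF m]
  have k: "?k < m" "slot m i ?k = i"
    using unslot_less[OF m m(2)] slot_unslot[OF m m(2)] ci by auto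
  have slot_k: "slot m i j = i \<longleftrightarrow> j = ?k" if "j < m" for j
    using that k unslot_slot[OF m that] by auto
  have suc_less: "cyc_suc (m - 1) j < m" if "j < m" for j
    using that m by (auto simp: cyc_suc_eq)
  have jx_less: "jx ! j < ?n" if "j < m" for j
    using that by (intro index_lists_nth[OF jx]) auto
  have A_entry: "As ! r $$ (a, b) \<in> carrier R" if "r \<le> m" "a < ?n" "b < ?n" for r a b
    using that As linear_mapsD(1)[OF mat_entry_linear[OF R]] by (auto simp: tensor_words_iff_nth)
  have x: "?x l \<in> carrier R" if "l < ?n" for l
    using that m ci k jx_less suc_less by (intro R.mult_closed A_entry) auto
  have B_word: "?B \<in> tensor_words R m"
    using cyclic_entries_word[of "contract (supermatrices R p q) m i As" "m - 1" jx]
      M.contract_word[OF m As] jx m by simp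
  have B_k: "?B ! ?k = (\<Oplus>\<^bsub>R\<^esub>l\<in>{..<?n}. ?x l)"
    using m k jx_less suc_less
    by (simp add: cyclic_entries_def contract_def mult_entry[OF R] less_Suc_eq_le del: upt_Suc)
  have E_nth: "cyclic_entries m As (?ix l) ! r = As ! r $$ (?ix l ! r, ?ix l ! cyc_suc m r)"
    if "r \<le> m" for r l
    using that by (simp add: cyclic_entries_def less_Suc_eq_le del: upt_Suc)
  have contract_E: "contract R m i (cyclic_entries m As (?ix l)) = ?B[?k := ?x l]" if l: "l < ?n" for l
  proof (rule nth_equalityI)
    fix j assume "j < length (contract R m i (cyclic_entries m As (?ix l)))"
    then have j: "j < m" by (simp add: contract_def)
    note ix = insert_index_nth(1)[OF m, of _ jx l] insert_index_nth(2)[OF m, of jx l]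
    have ix_suc: "jx ! cyc_suc (m - 1) j = ?ix l ! slot m i (cyc_suc (m - 1) j)"
      by (rule ix(1)[OF suc_less[OF j], symmetric])
    show "contract R m i (cyclic_entries m As (?ix l)) ! j = ?B[?k := ?x l] ! j"
    proof (cases "j = ?k")
      case True
      have "contract R m i (cyclic_entries m As (?ix l)) ! j =
          As ! i $$ (?ix l ! i, l) \<otimes>\<^bsub>R\<^esub> As ! ?c $$ (l, ?ix l ! cyc_suc m ?c)"
        using j True k ci m by (simp add: contract_def E_nth ix(2))
      also have "?ix l ! i = jx ! ?k" using ix(1)[OF k(1)] k(2) by simp
      also have "?ix l ! cyc_suc m ?c = jx ! cyc_suc (m - 1) ?k"
        using ix_suc slot_cyc_suc[OF m j] True k by simp
      finally show ?thesis
        using True k B_word by (simp add: tensor_words_def)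
    next
      case False
      then have ne: "slot m i j \<noteq> i" using slot_k[OF j] by blast
      have "contract R m i (cyclic_entries m As (?ix l)) ! j =
          As ! slot m i j $$ (?ix l ! slot m i j, ?ix l ! cyc_suc m (slot m i j))"
        using j ne slot_le[OF m j] by (simp add: contract_def E_nth)
      also have "\<dots> = As ! slot m i j $$ (jx ! j, jx ! cyc_suc (m - 1) j)"
        using ix(1)[OF j] ix_suc slot_cyc_suc[OF m j] ne by simp
      also have "\<dots> = ?B ! j"
        using j ne m by (simp add: cyclic_entries_def contract_def less_Suc_eq_le del: upt_Suc)
      finally show ?thesis using False by simp
    qed
  qed (use B_word in \<open>simp add: contract_def tensor_words_def\<close>)
  note T = module_tensor_power[OF R.module_axioms, of m]
  interpret T: module K "tensor_power K R m" by (rule T)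
  note lin = multilinearD(2)[OF multilinear_pure_tensor[OF R.module_axioms] B_word k(1)]
  have "pure_tensor K R ?B = pure_tensor K R (?B[?k := (\<Oplus>\<^bsub>R\<^esub>l\<in>{..<?n}. ?x l)])"
    by (simp only: B_k[symmetric] list_update_id)
  also have "\<dots> = (\<Oplus>\<^bsub>tensor_power K R m\<^esub>l\<in>{..<?n}. pure_tensor K R (?B[?k := ?x l]))"
    using x by (intro linear_maps_finsum[OF R.module_axioms T lin]) auto
  also have "\<dots> = (\<Oplus>\<^bsub>tensor_power K R m\<^esub>l\<in>{..<?n}.
      pure_tensor K R (contract R m i (cyclic_entries m As (?ix l))))"
  proof (rule T.finsum_cong'[OF refl Pi_I])
    fix l assume "l \<in> {..<?n}"
    then have l: "l < ?n" by simp
    show "pure_tensor K R (contract R m i (cyclic_entries m As (?ix l))) \<in> carrier (tensor_power K R m)"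
      unfolding contract_E[OF l] by (rule linear_mapsD(1)[OF lin x[OF l]])
    show "pure_tensor K R (?B[?k := ?x l]) =
        pure_tensor K R (contract R m i (cyclic_entries m As (?ix l)))"
      unfolding contract_E[OF l] ..
  qed
  finally show ?thesis .
qed

text \<open>Both sides are evaluated at a homogeneous pure tensor. On the left the face acts on each
  summand of the supertrace; on the right the product inside the contracted word contributes the
  sum over the inner index. The bijection of index lists matches the summands, and
  \<open>face_sign_supertrace\<close> matches their signs.\<close>

lemma hochschild_face_dennis_supertrace:
  assumes m: "m \<ge> 1" "i \<le> m"
    and t: "t \<in> carrier (tensor_power K (supermatrices R p q) (m + 1))"
  shows "hochschild_face K R m i (dennis_supertrace K R p q m t) =
    dennis_supertrace K R p q (m - 1) (hochschild_face K (supermatrices R p q) m i t)"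
proof -
  let ?n = "p + q" and ?M = "supermatrices R p q" and ?T = "tensor_power K R m"
  have m1: "m - 1 + 1 = m" using m by simp
  note T = module_tensor_power[OF R.module_axioms]
  interpret T: module K ?T by (rule T)
  note sign = parity_sign_closed[OF R.R.cring_axioms]
  note str' = dennis_supertrace[of "m - 1", unfolded m1]
  note face_R = R.hochschild_face[OF m] and face_M = M.hochschild_face[OF m]
  show ?thesis
  proof (rule M.linear_maps_eqI_homogeneous[OF T.module_axioms
        linear_maps_comp[OF face_R(1) dennis_supertrace(1)] linear_maps_comp[OF str'(1) face_M(1)] _ t])
    fix As es assume h: "M.homogeneous_word (m + 1) As es"
    note As = M.homogeneous_word_in_tensor_words[OF h]
    have len: "length es = m + 1" using h by (simp add: M.homogeneous_word_def)
    let ?E = "\<lambda>ix. cyclic_entries m As ix"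
    let ?c = "\<lambda>ix. pure_tensor K R (contract R m i (?E ix))"
    let ?\<tau> = "1 + (\<Sum>j\<le>m. es ! j)"
    let ?\<sigma> = "\<lambda>ix. parity_sign K (face_parity m i es + ?\<tau> * block_parity p (ix ! slot m i 0))"
    have c: "?c ix \<in> carrier ?T" if "ix \<in> index_lists ?n m" for ix
      by (intro pure_tensor_closed[OF R.module_axioms] R.contract_word[OF m] cyclic_entries_word As that)
    have ins: "insert_index m i jx l \<in> index_lists ?n m"
      if "jx \<in> index_lists ?n (m - 1)" "l < ?n" for jx l
      using bij_betw_apply[OF bij_betw_insert_index[OF m, of ?n], of "(jx, l)"] that by simp
    have E: "pure_tensor K R (?E ix) \<in> carrier (tensor_power K R (m + 1))"
      if "ix \<in> index_lists ?n m" for ix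
      by (intro pure_tensor_closed[OF R.module_axioms] cyclic_entries_word As that)
    interpret T1: module K "tensor_power K R (m + 1)" by (rule T)
    have "hochschild_face K R m i (dennis_supertrace K R p q m (pure_tensor K ?M As)) =
        (\<Oplus>\<^bsub>?T\<^esub>ix\<in>index_lists ?n m. hochschild_face K R m i
          (parity_sign K (supertrace_parity p m es ix) \<odot>\<^bsub>tensor_power K R (m + 1)\<^esub> pure_tensor K R (?E ix)))"
      unfolding dennis_supertrace(2)[OF h]
      by (intro linear_maps_finsum[OF T T face_R(1)] finite_index_lists Pi_I T1.smult_closed sign E)
    also have "\<dots> = (\<Oplus>\<^bsub>?T\<^esub>ix\<in>index_lists ?n m. ?\<sigma> ix \<odot>\<^bsub>?T\<^esub> ?c ix)"
    proof (intro T.finsum_cong' refl)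
      fix ix assume ix: "ix \<in> index_lists ?n m"
      have "hochschild_face K R m i
          (parity_sign K (supertrace_parity p m es ix) \<odot>\<^bsub>tensor_power K R (m + 1)\<^esub> pure_tensor K R (?E ix)) =
          parity_sign K (supertrace_parity p m es ix) \<odot>\<^bsub>?T\<^esub>
          (parity_sign K (face_parity m i (cyclic_parities p m es ix)) \<odot>\<^bsub>?T\<^esub> ?c ix)"
        unfolding linear_mapsD(3)[OF face_R(1) sign E[OF ix]]
          face_R(2)[OF homogeneous_cyclic_entries[OF h ix]] ..
      also have "\<dots> = ?\<sigma> ix \<odot>\<^bsub>?T\<^esub> ?c ix"
        unfolding face_sign_supertrace[OF m len, of p ix, symmetric]
        by (simp only: parity_sign_add[OF R.R.cring_axioms] T.smult_assoc1 sign c[OF ix])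
      finally show "hochschild_face K R m i
          (parity_sign K (supertrace_parity p m es ix) \<odot>\<^bsub>tensor_power K R (m + 1)\<^esub> pure_tensor K R (?E ix)) =
          ?\<sigma> ix \<odot>\<^bsub>?T\<^esub> ?c ix" .
    qed (use c sign in auto)
    \<comment> \<open>split an index list into the index between the merged matrices and the remaining ones\<close>
    also have "\<dots> = (\<Oplus>\<^bsub>?T\<^esub>x\<in>index_lists ?n (m - 1) \<times> {..<?n}. case x of (jx, l) \<Rightarrow>
        ?\<sigma> (insert_index m i jx l) \<odot>\<^bsub>?T\<^esub> ?c (insert_index m i jx l))"
    proof -
      note bij = bij_betw_insert_index[OF m, of ?n]
      note img = bij_betw_imp_surj_on[OF bij]
      have "(\<Oplus>\<^bsub>?T\<^esub>ix\<in>(\<lambda>(jx, l). insert_index m i jx l) ` (index_lists ?n (m - 1) \<times> {..<?n}).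
            ?\<sigma> ix \<odot>\<^bsub>?T\<^esub> ?c ix) =
          (\<Oplus>\<^bsub>?T\<^esub>x\<in>index_lists ?n (m - 1) \<times> {..<?n}. ?\<sigma> (case x of (jx, l) \<Rightarrow> insert_index m i jx l) \<odot>\<^bsub>?T\<^esub>
            ?c (case x of (jx, l) \<Rightarrow> insert_index m i jx l))"
        using c sign ins by (intro T.finsum_reindex bij_betw_imp_inj_on[OF bij]) auto
      then show ?thesis unfolding img by (simp add: case_prod_unfold)
    qed
    also have "\<dots> = (\<Oplus>\<^bsub>?T\<^esub>jx\<in>index_lists ?n (m - 1). \<Oplus>\<^bsub>?T\<^esub>l\<in>{..<?n}.
        ?\<sigma> (insert_index m i jx l) \<odot>\<^bsub>?T\<^esub> ?c (insert_index m i jx l))"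
      using c sign ins by (subst T.finsum_cartesian_product) (auto intro: finite_index_lists)
    \<comment> \<open>the sign depends only on the remaining indices, so the sum over \<open>l\<close> can be
      collected into a product of matrices\<close>
    also have "\<dots> = (\<Oplus>\<^bsub>?T\<^esub>jx\<in>index_lists ?n (m - 1). parity_sign K (face_parity m i es) \<odot>\<^bsub>?T\<^esub>
        (parity_sign K (supertrace_parity p (m - 1) (contract_parities m i es) jx) \<odot>\<^bsub>?T\<^esub>
          pure_tensor K R (cyclic_entries (m - 1) (contract ?M m i As) jx)))"
    proof (intro T.finsum_cong' refl)
      fix jx assume jx: "jx \<in> index_lists ?n (m - 1)"
      let ?s = "parity_sign K (supertrace_parity p (m - 1) (contract_parities m i es) jx)"
      have c_ins: "?c (insert_index m i jx l) \<in> carrier ?T" if "l < ?n" for l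
        using c[OF ins[OF jx that]] .
      have "?\<sigma> (insert_index m i jx l) = parity_sign K (face_parity m i es) \<otimes>\<^bsub>K\<^esub> ?s" for l
        using m insert_index_nth(1)[OF m, of 0 jx l] sum_contract_parities[OF m len]
        by (simp add: supertrace_parity_def parity_sign_add[OF R.R.cring_axioms])
      then have "(\<Oplus>\<^bsub>?T\<^esub>l\<in>{..<?n}. ?\<sigma> (insert_index m i jx l) \<odot>\<^bsub>?T\<^esub> ?c (insert_index m i jx l)) =
          (parity_sign K (face_parity m i es) \<otimes>\<^bsub>K\<^esub> ?s) \<odot>\<^bsub>?T\<^esub>
            (\<Oplus>\<^bsub>?T\<^esub>l\<in>{..<?n}. ?c (insert_index m i jx l))"
        using c_ins sign by (simp only:) (intro T.finsum_smult_ldistr[symmetric]; auto)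
      also have "\<dots> = parity_sign K (face_parity m i es) \<odot>\<^bsub>?T\<^esub> (?s \<odot>\<^bsub>?T\<^esub>
          (\<Oplus>\<^bsub>?T\<^esub>l\<in>{..<?n}. ?c (insert_index m i jx l)))"
        using c_ins sign by (intro T.smult_assoc1 T.finsum_closed) auto
      finally show "(\<Oplus>\<^bsub>?T\<^esub>l\<in>{..<?n}. ?\<sigma> (insert_index m i jx l) \<odot>\<^bsub>?T\<^esub> ?c (insert_index m i jx l)) =
          parity_sign K (face_parity m i es) \<odot>\<^bsub>?T\<^esub> (?s \<odot>\<^bsub>?T\<^esub>
            pure_tensor K R (cyclic_entries (m - 1) (contract ?M m i As) jx))"
        unfolding pure_tensor_contract_cyclic_entries[OF m As jx] .
    next
      have "pure_tensor K R (cyclic_entries (m - 1) (contract ?M m i As) jx) \<in> carrier ?T"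
        if "jx \<in> index_lists ?n (m - 1)" for jx
        using multilinearD(1)[OF multilinear_cyclic_entries[OF that, unfolded m1] M.contract_word[OF m As]] .
      then show "(\<lambda>jx. parity_sign K (face_parity m i es) \<odot>\<^bsub>?T\<^esub>
          (parity_sign K (supertrace_parity p (m - 1) (contract_parities m i es) jx) \<odot>\<^bsub>?T\<^esub>
          pure_tensor K R (cyclic_entries (m - 1) (contract ?M m i As) jx))) \<in>
          index_lists ?n (m - 1) \<rightarrow> carrier ?T"
        using sign by auto
    qed
    also have "\<dots> = parity_sign K (face_parity m i es) \<odot>\<^bsub>?T\<^esub>
        dennis_supertrace K R p q (m - 1) (pure_tensor K ?M (contract ?M m i As))"
    proof -
      have "pure_tensor K R (cyclic_entries (m - 1) (contract ?M m i As) jx) \<in> carrier ?T"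
        if "jx \<in> index_lists ?n (m - 1)" for jx
        using multilinearD(1)[OF multilinear_cyclic_entries[OF that, unfolded m1] M.contract_word[OF m As]] .
      then show ?thesis
        unfolding str'(2)[OF M.homogeneous_contract[OF m h]]
        using sign by (intro T.finsum_smult_ldistr[symmetric] finite_index_lists) auto
    qed
    also have "\<dots> = dennis_supertrace K R p q (m - 1)
        (parity_sign K (face_parity m i es) \<odot>\<^bsub>tensor_power K ?M m\<^esub> pure_tensor K ?M (contract ?M m i As))"
      by (rule linear_mapsD(3)[OF str'(1), symmetric])
        (intro sign pure_tensor_closed[OF M.module_axioms] M.contract_word[OF m As])+
    also have "\<dots> = dennis_supertrace K R p q (m - 1)
        (hochschild_face K ?M m i (pure_tensor K ?M As))"
      unfolding face_M(2)[OF h] ..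
    finally show "hochschild_face K R m i (dennis_supertrace K R p q m (pure_tensor K ?M As)) =
        dennis_supertrace K R p q (m - 1) (hochschild_face K ?M m i (pure_tensor K ?M As))" .
  qed
qed

lemma hochschild_diff_dennis_supertrace:
  assumes m: "m \<ge> 1" and t: "t \<in> carrier (tensor_power K (supermatrices R p q) (m + 1))"
  shows "hochschild_diff K R m (dennis_supertrace K R p q m t) =
    dennis_supertrace K R p q (m - 1) (hochschild_diff K (supermatrices R p q) m t)"
proof -
  let ?M = "supermatrices R p q"
  let ?TR = "tensor_power K R m" and ?TM = "tensor_power K ?M m"
  let ?c = "\<lambda>i::nat. (\<ominus>\<^bsub>K\<^esub> \<one>\<^bsub>K\<^esub>) [^]\<^bsub>K\<^esub> i"
  have m1: "m - 1 + 1 = m" using m by simp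
  have chains: "hochschild_chains K S (m - 1) = tensor_power K S m" for S :: "('k, 'b, 'x) module_scheme"
    unfolding hochschild_chains_def m1 ..
  interpret TR: module K ?TR by (rule module_tensor_power[OF R.module_axioms])
  interpret TM: module K ?TM by (rule module_tensor_power[OF M.module_axioms])
  note str' = dennis_supertrace(1)[of "m - 1", unfolded m1]
  have c: "?c i \<in> carrier K" for i by (simp add: R.R.nat_pow_closed)
  have face: "hochschild_face K ?M m i t \<in> carrier ?TM" if "i \<le> m" for i
    using linear_mapsD(1)[OF M.hochschild_face(1)[OF m that] t] .
  note strD = linear_mapsD[OF str']
  have "hochschild_diff K R m (dennis_supertrace K R p q m t) =
      (\<Oplus>\<^bsub>?TR\<^esub>i\<in>{..m}. ?c i \<odot>\<^bsub>?TR\<^esub> hochschild_face K R m i (dennis_supertrace K R p q m t))"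
    unfolding hochschild_diff_def chains using m by simp
  also have "\<dots> = (\<Oplus>\<^bsub>?TR\<^esub>i\<in>{..m}. dennis_supertrace K R p q (m - 1)
      (?c i \<odot>\<^bsub>?TM\<^esub> hochschild_face K ?M m i t))"
    using c face strD m t
    by (intro TR.finsum_cong') (auto simp: hochschild_face_dennis_supertrace)
  also have "\<dots> = dennis_supertrace K R p q (m - 1)
      (\<Oplus>\<^bsub>?TM\<^esub>i\<in>{..m}. ?c i \<odot>\<^bsub>?TM\<^esub> hochschild_face K ?M m i t)"
    using c face by (intro linear_maps_finsum[OF TM.module_axioms TR.module_axioms str', symmetric]) auto
  also have "\<dots> = dennis_supertrace K R p q (m - 1) (hochschild_diff K ?M m t)"
    unfolding hochschild_diff_def chains using m by simp
  finally show ?thesis .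
qed

end

theorem theorem1:
  fixes K :: "('k, 'z) ring_scheme"
    and R :: "('k, 'a, 'y) superalgebra_scheme"
    and p q :: nat
  assumes "superalgebra K R"
    and "p + q \<ge> 1"
  shows "(\<forall>m. dennis_supertrace K R p q m \<in>
            linear_maps K (hochschild_chains K (supermatrices R p q) m) (hochschild_chains K R m)) \<and>
         (\<forall>m\<ge>1. \<forall>t\<in>carrier (hochschild_chains K (supermatrices R p q) m).
            hochschild_diff K R m (dennis_supertrace K R p q m t) =
            dennis_supertrace K R p q (m - 1) (hochschild_diff K (supermatrices R p q) m t))"
  using superalgebra_imp_graded_algebra[OF assms(1)]
  by (simp add: hochschild_chains_def dennis_supertrace(1)[simplified] hochschild_diff_dennis_supertrace[simplified])

end
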